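(* Assume that $X$ has the Vitali–Carathéodory property. (a) If $\mathcal P$ is proper (all closed balls are compact), then $C_X$ is an outer capacity. (b) If $\mathcal P$ is locally compact, then every weakly quasicontinuous function $u:\mathcal P\to[-\infty,\infty]$ is quasicontinuous.
   Context: Standing assumptions: $\mathcal P=(\mathcal P,d,\mu)$ is a metric space with a positive complete Borel measure $\mu$ such that $0<\mu(B)<\infty$ for every ball $B$; $\mu$ is extended as an outer measure to all subsets. A quasi-Banach function lattice $X=X(\mathcal P)$ is a vector space of extended real-valued measurable functions defined everywhere on $\mathcal P$ with a functional $\|\cdot\|_X$ such that: $X=\{u:\|u\|_X<\infty\}$; $\|u\|_X=0$ iff $u=0$ a.e., $\|au\|_X=|a|\|u\|_X$, and $\|u+v\|_X\le c_\wedge(\|u\|_X+\|v\|_X)$ for some constant $c_\wedge\ge1$; $|u|\le|v|$ a.e. implies $\|u\|_X\le\|v\|_X$; and if $u_n\ge0$ a.e. then $\|\sum_{n\ge1}u_n\|_X\le\sum_{n\ge1}c_\wedge^n\|u_n\|_X$. The quasinorm is assumed continuous: $\|u_n-u\|_X\to0$ implies $\|u_n\|_X\to\|u\|_X$. $X$ has the Vitali–Carathéodory property if for every measurable $u$, $\|u\|_X=\inf\{\|v\|_X: v\ge|u|,\ v \text{ lower semicontinuous on }\mathcal P\}$. A Borel $g:\mathcal P\to[0,\infty]$ is an upper gradient of $u:\mathcal P\to[-\infty,\infty]$ if $|u(\gamma(0))-u(\gamma(l_\gamma))|\le\int_\gamma g\,ds$ for every nonconstant rectifiable (arc-length parametrized)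 curve $\gamma:[0,l_\gamma]\to\mathcal P$. $N^1X(\mathcal P)=\{u\in X:\|u\|_{N^1X}:=\|u\|_X+\inf_g\|g\|_X<\infty\}$, infimum over upper gradients. $C_X(E)=\inf\{\|u\|_{N^1X}:u\in N^1X,\ u\ge1\text{ on }E\}$. $C_X$ is an outer capacity if $C_X(E)=\inf\{C_X(G):G\supset E\text{ open}\}$ for all $E\subset\mathcal P$. $u:\mathcal P\to[-\infty,\infty]$ is weakly quasicontinuous if for every $\varepsilon>0$ there is $E$ with $C_X(E)<\varepsilon$ and $u|_{\mathcal P\setminus E}$ (real-valued) continuous; quasicontinuous if $E$ can be chosen open. *)

theory Defs
  imports "HOL-Analysis.Analysis"
begin

definition mm_space :: "'a::metric_space measure \<Rightarrow> bool" where
  "mm_space M \<longleftrightarrow> space M = UNIV \<and> sets borel \<subseteq> sets M \<and> complete_measure M \<and>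
     (\<forall>x r. r > 0 \<longrightarrow> 0 < emeasure M (ball x r) \<and> emeasure M (ball x r) < \<infinity>)"

definition in_X :: "'a measure \<Rightarrow> (('a \<Rightarrow> ereal) \<Rightarrow> ennreal) \<Rightarrow> ('a \<Rightarrow> ereal) \<Rightarrow> bool" where
  "in_X M nX u \<longleftrightarrow> u \<in> borel_measurable M \<and> nX u < \<infinity>"

definition qBFL :: "'a measure \<Rightarrow> (('a \<Rightarrow> ereal) \<Rightarrow> ennreal) \<Rightarrow> bool" where
  "qBFL M nX \<longleftrightarrow>
    (\<exists>c::real. c \<ge> 1 \<and>
      (\<forall>u. u \<in> borel_measurable M \<longrightarrow> (nX u = 0 \<longleftrightarrow> (AE x in M. u x = 0))) \<and>
      (\<forall>u (a::real). u \<in> borel_measurable M \<longrightarrow>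
          nX (\<lambda>x. ereal a * u x) = ennreal \<bar>a\<bar> * nX u) \<and>
      (\<forall>u v. u \<in> borel_measurable M \<longrightarrow> v \<in> borel_measurable M \<longrightarrow>
          nX (\<lambda>x. u x + v x) \<le> ennreal c * (nX u + nX v)) \<and>
      (\<forall>u v. u \<in> borel_measurable M \<longrightarrow> v \<in> borel_measurable M \<longrightarrow>
          (AE x in M. \<bar>u x\<bar> \<le> \<bar>v x\<bar>) \<longrightarrow> nX u \<le> nX v) \<and>
      (\<forall>us :: nat \<Rightarrow> 'a \<Rightarrow> ereal. (\<forall>n. us n \<in> borel_measurable M \<and> (\<forall>x. 0 \<le> us n x)) \<longrightarrow>
          nX (\<lambda>x. \<Sum>n. us n x) \<le> (\<Sum>n. ennreal (c ^ Suc n) * nX (us n))))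
    \<and> (\<forall>us u. (\<forall>n. in_X M nX (us n)) \<longrightarrow> in_X M nX u \<longrightarrow>
          (\<lambda>n. nX (\<lambda>x. us n x - u x)) \<longlonglongrightarrow> 0 \<longrightarrow> (\<lambda>n. nX (us n)) \<longlonglongrightarrow> nX u)"

definition lsc :: "('a::topological_space \<Rightarrow> ereal) \<Rightarrow> bool" where
  "lsc v \<longleftrightarrow> (\<forall>t. open {x. t < v x})"

definition vitali_caratheodory :: "'a::topological_space measure \<Rightarrow> (('a \<Rightarrow> ereal) \<Rightarrow> ennreal) \<Rightarrow> bool" where
  "vitali_caratheodory M nX \<longleftrightarrow>
     (\<forall>u. u \<in> borel_measurable M \<longrightarrow>
        nX u = (INF v \<in> {v. lsc v \<and> (\<forall>x. \<bar>u x\<bar> \<le> v x)}. nX v))"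

definition curve_length :: "(real \<Rightarrow> 'a::metric_space) \<Rightarrow> real \<Rightarrow> real \<Rightarrow> ereal" where
  "curve_length \<gamma> a b =
     (SUP p \<in> {(n, t). t 0 = a \<and> t n = b \<and> (\<forall>i<n. t i \<le> t (Suc i))}.
        ereal (\<Sum>i<fst p. dist (\<gamma> (snd p i)) (\<gamma> (snd p (Suc i)))))"

definition arc_length_curve :: "(real \<Rightarrow> 'a::metric_space) \<Rightarrow> real \<Rightarrow> bool" where
  "arc_length_curve \<gamma> l \<longleftrightarrow> 0 < l \<and>
     (\<forall>s t. 0 \<le> s \<and> s \<le> t \<and> t \<le> l \<longrightarrow> curve_length \<gamma> s t = ereal (t - s))"

definition line_integral :: "('a \<Rightarrow> ennreal) \<Rightarrow> (real \<Rightarrow> 'a) \<Rightarrow> real \<Rightarrow> ennreal" where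
  "line_integral g \<gamma> l = (\<integral>\<^sup>+ t. g (\<gamma> t) * indicator {0..l} t \<partial>lborel)"

text \<open>|a - b| with the convention |(+-oo) - (+-oo)| = oo.\<close>
definition ediff :: "ereal \<Rightarrow> ereal \<Rightarrow> ennreal" where
  "ediff a b = (if \<bar>a\<bar> \<noteq> \<infinity> \<and> \<bar>b\<bar> \<noteq> \<infinity>
                then ennreal \<bar>real_of_ereal a - real_of_ereal b\<bar> else \<infinity>)"

definition upper_gradient :: "('a::metric_space \<Rightarrow> ennreal) \<Rightarrow> ('a \<Rightarrow> ereal) \<Rightarrow> bool" where
  "upper_gradient g u \<longleftrightarrow> g \<in> borel_measurable borel \<and>
     (\<forall>\<gamma> l. arc_length_curve \<gamma> l \<longrightarrow> ediff (u (\<gamma> 0)) (u (\<gamma> l)) \<le> line_integral g \<gamma> l)"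

definition N1_norm :: "(('a::metric_space \<Rightarrow> ereal) \<Rightarrow> ennreal) \<Rightarrow> ('a \<Rightarrow> ereal) \<Rightarrow> ennreal" where
  "N1_norm nX u = nX u + (INF g \<in> {g. upper_gradient g u}. nX (\<lambda>x. enn2ereal (g x)))"

definition in_N1X :: "'a::metric_space measure \<Rightarrow> (('a \<Rightarrow> ereal) \<Rightarrow> ennreal) \<Rightarrow> ('a \<Rightarrow> ereal) \<Rightarrow> bool" where
  "in_N1X M nX u \<longleftrightarrow> in_X M nX u \<and> N1_norm nX u < \<infinity>"

definition capacity :: "'a::metric_space measure \<Rightarrow> (('a \<Rightarrow> ereal) \<Rightarrow> ennreal) \<Rightarrow> 'a set \<Rightarrow> ennreal" where
  "capacity M nX E = (INF u \<in> {u. in_N1X M nX u \<and> (\<forall>x\<in>E. 1 \<le> u x)}. N1_norm nX u)"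

definition outer_capacity :: "'a::metric_space measure \<Rightarrow> (('a \<Rightarrow> ereal) \<Rightarrow> ennreal) \<Rightarrow> bool" where
  "outer_capacity M nX \<longleftrightarrow>
     (\<forall>E. capacity M nX E = (INF G \<in> {G. open G \<and> E \<subseteq> G}. capacity M nX G))"

definition weakly_quasicontinuous ::
  "'a::metric_space measure \<Rightarrow> (('a \<Rightarrow> ereal) \<Rightarrow> ennreal) \<Rightarrow> ('a \<Rightarrow> ereal) \<Rightarrow> bool" where
  "weakly_quasicontinuous M nX u \<longleftrightarrow>
     (\<forall>\<epsilon>::real. \<epsilon> > 0 \<longrightarrow> (\<exists>E. capacity M nX E < ennreal \<epsilon> \<and>
        (\<forall>x \<in> - E. \<bar>u x\<bar> \<noteq> \<infinity>) \<and> continuous_on (- E) (\<lambda>x. real_of_ereal (u x))))"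

definition quasicontinuous ::
  "'a::metric_space measure \<Rightarrow> (('a \<Rightarrow> ereal) \<Rightarrow> ennreal) \<Rightarrow> ('a \<Rightarrow> ereal) \<Rightarrow> bool" where
  "quasicontinuous M nX u \<longleftrightarrow>
     (\<forall>\<epsilon>::real. \<epsilon> > 0 \<longrightarrow> (\<exists>E. open E \<and> capacity M nX E < ennreal \<epsilon> \<and>
        (\<forall>x \<in> - E. \<bar>u x\<bar> \<noteq> \<infinity>) \<and> continuous_on (- E) (\<lambda>x. real_of_ereal (u x))))"

end

theory Submission
  imports Defs "HOL-Library.Diagonal_Subsequence"
begin

text \<open>
  Let \<open>w\<close> be admissible for \<open>E\<close> with upper gradient \<open>g\<close>. By the Vitali--Caratheodory property there are
  lower semicontinuous \<open>h \<ge> w\<close> and \<open>k \<ge> g\<close> with almost the same norms. The function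
  \<open>v x = inf (h y + \<integral>\<^sub>\<gamma> k ds)\<close>, the infimum being over the curves \<open>\<gamma>\<close> from \<open>x\<close> to arbitrary points \<open>y\<close>,
  satisfies \<open>w \<le> v \<le> h\<close> and has \<open>k\<close> as an upper gradient. If \<open>k \<ge> \<delta> * h\<close>, curves of bounded cost have bounded
  length until they meet \<open>{h \<le> \<epsilon>}\<close>, so in a proper space the Arzela--Ascoli theorem and Fatou's lemma show
  that \<open>v\<close> is lower semicontinuous. Hence \<open>{v > 1}\<close> is open, and, after scaling by a factor close to 1,
  contains \<open>E\<close> and has capacity close to that of \<open>E\<close>; adding \<open>\<delta> * h\<close> to \<open>k\<close> costs nothing by the continuity of
  the quasinorm.

  In a locally compact space the same construction with \<open>h\<close> cut off outside a relatively compact ball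
  encloses each subset of a smaller ball in an open set of comparable capacity. The exceptional sets
  of a weakly quasicontinuous function are enclosed in this way ball by ball, with an exceptional set
  for each ball that is small enough to absorb the constants.
\<close>

section \<open>Arc-length reparametrization of Lipschitz curves\<close>

abbreviation lip1 :: "(real \<Rightarrow> 'a::metric_space) \<Rightarrow> bool" where
  "lip1 \<gamma> \<equiv> 1-lipschitz_on UNIV \<gamma>"

lemma lip1D: "lip1 \<gamma> \<Longrightarrow> dist (\<gamma> s) (\<gamma> t) \<le> \<bar>s - t\<bar>"
  using lipschitz_onD[of 1 UNIV \<gamma> s t] by (simp add: dist_real_def)

lemma lip1I: "(\<And>s t. s \<le> t \<Longrightarrow> dist (\<gamma> s) (\<gamma> t) \<le> t - s) \<Longrightarrow> lip1 \<gamma>"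
proof (rule lipschitz_onI)
  fix s t :: real
  assume *: "\<And>s t. s \<le> t \<Longrightarrow> dist (\<gamma> s) (\<gamma> t) \<le> t - s"
  show "dist (\<gamma> s) (\<gamma> t) \<le> 1 * dist s t"
    using *[of s t] *[of t s] by (cases "s \<le> t") (auto simp: dist_real_def dist_commute)
qed auto

lemma lip1_measurable [measurable]: "lip1 \<gamma> \<Longrightarrow> \<gamma> \<in> borel_measurable borel"
  by (intro borel_measurable_continuous_onI lipschitz_on_continuous_on)

section \<open>Partitions and polygonal length\<close>

definition is_partition :: "(nat \<Rightarrow> real) \<Rightarrow> nat \<Rightarrow> real \<Rightarrow> real \<Rightarrow> bool" where
  "is_partition p n a b \<longleftrightarrow> p 0 = a \<and> p n = b \<and> (\<forall>i<n. p i \<le> p (Suc i))"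

abbreviation polygon_length :: "(real \<Rightarrow> 'a::metric_space) \<Rightarrow> (nat \<Rightarrow> real) \<Rightarrow> nat \<Rightarrow> real" where
  "polygon_length \<gamma> p n \<equiv> \<Sum>i<n. dist (\<gamma> (p i)) (\<gamma> (p (Suc i)))"

lemma is_partition_bounds:
  assumes "is_partition p n a b" "i \<le> n"
  shows "a \<le> p i" "p i \<le> b"
proof -
  have "p 0 \<le> p i" using assms(2)
    by (induction i) (use assms(1) in \<open>auto simp: is_partition_def intro: order_trans\<close>)
  then show "a \<le> p i" using assms(1) by (simp add: is_partition_def)
  have "p i \<le> p n" using assms(2)
  proof (induction rule: inc_induct)
    case (step j)
    then have "p j \<le> p (Suc j)" using assms(1) by (auto simp: is_partition_def)
    with step show ?case by simp
  qed simp
  then show "p i \<le> b" using assms(1) by (simp add: is_partition_def)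
qed

lemma is_partition_append:
  assumes "is_partition p n a b" "is_partition q m b c"
  defines "r \<equiv> \<lambda>i. if i \<le> n then p i else q (i - n)"
  shows "is_partition r (n + m) a c"
    and "polygon_length \<gamma> r (n + m) = polygon_length \<gamma> p n + polygon_length \<gamma> q m"
proof -
  have pq: "p n = q 0" using assms by (simp add: is_partition_def)
  have r: "r (n + i) = q i" for i using pq by (simp add: r_def)
  show "is_partition r (n + m) a c"
    unfolding is_partition_def
  proof (intro conjI allI impI)
    show "r 0 = a" "r (n + m) = c" using assms(1,2) r[of m] by (auto simp: is_partition_def r_def)
    fix i assume "i < n + m"
    show "r i \<le> r (Suc i)"
    proof (cases "i < n")
      case True
      then show ?thesis using assms(1) by (auto simp: r_def is_partition_def)
    next
      case False
      then obtain j where j: "i = n + j" "j < m" using \<open>i < n + m\<close> by (metis add_less_cancel_left le_add_diff_inverse not_less)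
      then show ?thesis using assms(2) r[of j] r[of "Suc j"] by (simp add: is_partition_def)
    qed
  qed
  have "polygon_length \<gamma> r (n + k) = polygon_length \<gamma> p n + polygon_length \<gamma> q k" for k
  proof (induction k)
    case 0
    show ?case by (simp add: r_def)
  next
    case (Suc k)
    then show ?case using r[of k] r[of "Suc k"] by simp
  qed
  then show "polygon_length \<gamma> r (n + m) = polygon_length \<gamma> p n + polygon_length \<gamma> q m" .
qed

lemma is_partition_single: "a \<le> b \<Longrightarrow> is_partition (\<lambda>i. if i = 0 then a else b) 1 a b"
  by (auto simp: is_partition_def)

lemma polygon_length_le_curve_length:
  "is_partition p n a b \<Longrightarrow> ereal (polygon_length \<gamma> p n) \<le> curve_length \<gamma> a b"
  unfolding curve_length_def is_partition_def by (rule SUP_upper2[of "(n, p)"]) auto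

lemma curve_length_leI:
  "(\<And>p n. is_partition p n a b \<Longrightarrow> polygon_length \<gamma> p n \<le> C) \<Longrightarrow> curve_length \<gamma> a b \<le> ereal C"
  unfolding curve_length_def is_partition_def by (rule SUP_least) auto

lemma dist_le_curve_length: "a \<le> b \<Longrightarrow> ereal (dist (\<gamma> a) (\<gamma> b)) \<le> curve_length \<gamma> a b"
  using polygon_length_le_curve_length[OF is_partition_single, of a b \<gamma>] by simp

section \<open>The length function of a 1-Lipschitz curve\<close>

definition lip_length :: "(real \<Rightarrow> 'a::metric_space) \<Rightarrow> real \<Rightarrow> real \<Rightarrow> real" where
  "lip_length \<gamma> a b = real_of_ereal (curve_length \<gamma> a b)"

context
  fixes \<gamma> :: "real \<Rightarrow> 'a::metric_space"
  assumes lip: "lip1 \<gamma>"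
begin

lemma curve_length_le_lip: "curve_length \<gamma> a b \<le> ereal (b - a)"
proof (rule curve_length_leI)
  fix p n assume p: "is_partition p n a b"
  have "polygon_length \<gamma> p n \<le> (\<Sum>i<n. p (Suc i) - p i)"
  proof (intro sum_mono)
    fix i assume "i \<in> {..<n}"
    then show "dist (\<gamma> (p i)) (\<gamma> (p (Suc i))) \<le> p (Suc i) - p i"
      using p lip1D[OF lip, of "p i" "p (Suc i)"] by (auto simp: is_partition_def)
  qed
  also have "\<dots> = b - a" using p by (simp add: sum_lessThan_telescope is_partition_def)
  finally show "polygon_length \<gamma> p n \<le> b - a" .
qed

text \<open>The Lipschitz bound from above and the distance of the end points from below make the
  length finite, so nothing is lost by passing to reals. For \<open>b < a\<close> there are no
  partitions and the supremum is minus infinity.\<close>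

lemma curve_length_eq_lip_length: "a \<le> b \<Longrightarrow> curve_length \<gamma> a b = ereal (lip_length \<gamma> a b)"
proof -
  assume "a \<le> b"
  have "0 \<le> ereal (dist (\<gamma> a) (\<gamma> b))" by simp
  also have "\<dots> \<le> curve_length \<gamma> a b" using \<open>a \<le> b\<close> by (rule dist_le_curve_length)
  finally show ?thesis using curve_length_le_lip[of a b] unfolding lip_length_def
    by (cases "curve_length \<gamma> a b") auto
qed

lemma polygon_length_le_lip_length:
  "a \<le> b \<Longrightarrow> is_partition p n a b \<Longrightarrow> polygon_length \<gamma> p n \<le> lip_length \<gamma> a b"
  using polygon_length_le_curve_length[of p n a b \<gamma>] by (simp add: curve_length_eq_lip_length)

lemma lip_length_leI:
  "a \<le> b \<Longrightarrow> (\<And>p n. is_partition p n a b \<Longrightarrow> polygon_length \<gamma> p n \<le> C) \<Longrightarrow> lip_length \<gamma> a b \<le> C"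
  using curve_length_leI[of a b \<gamma> C] by (simp add: curve_length_eq_lip_length)

lemma lip_length_le: "a \<le> b \<Longrightarrow> lip_length \<gamma> a b \<le> b - a"
  using curve_length_le_lip[of a b] by (simp add: curve_length_eq_lip_length)

lemma dist_le_lip_length: "a \<le> b \<Longrightarrow> dist (\<gamma> a) (\<gamma> b) \<le> lip_length \<gamma> a b"
  using dist_le_curve_length[of a b \<gamma>] by (simp add: curve_length_eq_lip_length)

text \<open>Partitions of the two intervals concatenate. The suprema are taken one after the other,
  the second with the first polygon held fixed.\<close>

lemma lip_length_superadd:
  assumes "a \<le> b" "b \<le> c"
  shows "lip_length \<gamma> a b + lip_length \<gamma> b c \<le> lip_length \<gamma> a c"
proof -
  have "lip_length \<gamma> b c \<le> lip_length \<gamma> a c - polygon_length \<gamma> p n" if p: "is_partition p n a b" for p n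
  proof (rule lip_length_leI[OF assms(2)])
    fix q m assume q: "is_partition q m b c"
    show "polygon_length \<gamma> q m \<le> lip_length \<gamma> a c - polygon_length \<gamma> p n"
      using polygon_length_le_lip_length[OF _ is_partition_append(1)[OF p q]] assms
        is_partition_append(2)[OF p q, of \<gamma>] by simp
  qed
  then have "lip_length \<gamma> a b \<le> lip_length \<gamma> a c - lip_length \<gamma> b c"
    by (intro lip_length_leI assms(1)) fastforce
  then show ?thesis by simp
qed

text \<open>Induction on the number of edges with the right end free. If \<open>b\<close> lies
  before the last edge, the induction hypothesis applies; otherwise \<open>b\<close> lies on the
  last edge, which the triangle inequality splits there.\<close>

lemma polygon_length_le_split:
  assumes "is_partition p n a c" "a \<le> b" "b \<le> c"
  shows "polygon_length \<gamma> p n \<le> lip_length \<gamma> a b + lip_length \<gamma> b c"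
  using assms
proof (induction n arbitrary: c)
  case 0
  have "0 \<le> lip_length \<gamma> a b" "0 \<le> lip_length \<gamma> b c"
    using dist_le_lip_length[OF 0(2)] dist_le_lip_length[OF 0(3)] by (meson zero_le_dist order_trans)+
  then show ?case by simp
next
  case (Suc n)
  have p: "is_partition p n a (p n)" "p n \<le> c" "p (Suc n) = c"
    using Suc.prems(1) by (auto simp: is_partition_def)
  have apn: "a \<le> p n" using is_partition_bounds[OF p(1), of n] by simp
  show ?case
  proof (cases "b \<le> p n")
    case True
    have "polygon_length \<gamma> p n \<le> lip_length \<gamma> a b + lip_length \<gamma> b (p n)"
      using Suc.IH[OF p(1) Suc.prems(2) True] .
    moreover have "lip_length \<gamma> b (p n) + dist (\<gamma> (p n)) (\<gamma> c) \<le> lip_length \<gamma> b c"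
      using lip_length_superadd[OF True p(2)] dist_le_lip_length[OF p(2)] by linarith
    ultimately show ?thesis using p(3) by simp
  next
    case False
    have "polygon_length \<gamma> p n + dist (\<gamma> (p n)) (\<gamma> b) \<le> lip_length \<gamma> a b"
      using lip_length_superadd[of a "p n" b] dist_le_lip_length[of "p n" b] False apn
        polygon_length_le_lip_length[OF apn p(1)] by simp
    moreover have "dist (\<gamma> (p n)) (\<gamma> c) \<le> dist (\<gamma> (p n)) (\<gamma> b) + lip_length \<gamma> b c"
      using dist_triangle[of "\<gamma> (p n)" "\<gamma> c" "\<gamma> b"] dist_le_lip_length[OF Suc.prems(3)] by simp
    ultimately show ?thesis using p(3) by simp
  qed
qed

lemma lip_length_add:
  assumes "a \<le> b" "b \<le> c"
  shows "lip_length \<gamma> a c = lip_length \<gamma> a b + lip_length \<gamma> b c"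
  using lip_length_superadd[OF assms] lip_length_leI[of a c "lip_length \<gamma> a b + lip_length \<gamma> b c"]
    polygon_length_le_split[OF _ assms] assms by fastforce

lemma lip_length_nonneg: "a \<le> b \<Longrightarrow> 0 \<le> lip_length \<gamma> a b"
  using dist_le_lip_length[of a b] by (meson zero_le_dist order_trans)

end

text \<open>The arc-length parametrization is \<open>\<lambda>r. \<gamma> (\<tau> r)\<close>, where \<open>\<tau>\<close> is any right inverse of the
  length function \<open>lip_length \<gamma> 0\<close>.\<close>

lemma arc_length_reparametrization:
  fixes \<gamma> :: "real \<Rightarrow> 'a::metric_space"
  assumes lip: "lip1 \<gamma>" and T: "0 \<le> T" and ne: "\<gamma> 0 \<noteq> \<gamma> T"
  defines "L \<equiv> lip_length \<gamma> 0"
  obtains \<sigma> where "arc_length_curve \<sigma> (L T)" "\<And>t. t \<in> {0..T} \<Longrightarrow> \<sigma> (L t) = \<gamma> t" "L 0 = 0"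
    "\<And>s t. 0 \<le> s \<Longrightarrow> s \<le> t \<Longrightarrow> L s \<le> L t \<and> L t - L s \<le> t - s"
proof -
  have diff: "L t - L s = lip_length \<gamma> s t" if "0 \<le> s" "s \<le> t" for s t
    using lip_length_add[OF lip that] by (simp add: L_def)
  have L0: "L 0 = 0" using lip_length_nonneg[OF lip, of 0 0] lip_length_le[OF lip, of 0 0] by (simp add: L_def)
  have Lip: "L s \<le> L t \<and> L t - L s \<le> t - s" if "0 \<le> s" "s \<le> t" for s t
    using diff[OF that] lip_length_nonneg[OF lip that(2)] lip_length_le[OF lip that(2)] by simp
  \<comment> \<open>Thus \<gamma> is 1-Lipschitz with respect to \<open>L\<close>; in particular it
    takes equal values where \<open>L\<close> does, so the choice of preimage in
    \<open>\<tau>\<close> does not affect \<open>\<sigma>\<close>.\<close>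
  have dist: "dist (\<gamma> s) (\<gamma> t) \<le> \<bar>L t - L s\<bar>" if "0 \<le> s" "0 \<le> t" for s t
    using diff[of s t] diff[of t s] dist_le_lip_length[OF lip, of s t] dist_le_lip_length[OF lip, of t s] that
    by (cases "s \<le> t") (auto simp: dist_commute)
  have "continuous_on {0..T} L"
    by (rule lipschitz_on_continuous_on[of 1], rule lipschitz_onI)
      (use Lip in \<open>auto simp: dist_real_def abs_if not_less, (smt (verit))+\<close>)
  then have ex: "\<exists>t. t \<in> {0..T} \<and> L t = r" if "r \<in> {0..L T}" for r
    using IVT'[of L 0 r T] that T L0 by auto
  define \<tau> where "\<tau> r = (SOME t. t \<in> {0..T} \<and> L t = r)" for r
  have \<tau>: "\<tau> r \<in> {0..T}" "L (\<tau> r) = r" if "r \<in> {0..L T}" for r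
    using someI_ex[OF ex[OF that]] by (auto simp: \<tau>_def)
  define \<sigma> where "\<sigma> r = \<gamma> (\<tau> r)" for r
  have \<sigma>L: "\<sigma> (L t) = \<gamma> t" if "t \<in> {0..T}" for t
  proof -
    have "L t \<in> {0..L T}" using Lip[of 0 t] Lip[of t T] L0 that by auto
    then have "dist (\<gamma> (\<tau> (L t))) (\<gamma> t) \<le> 0" using dist[of "\<tau> (L t)" t] \<tau>[of "L t"] that by auto
    then show ?thesis by (simp add: \<sigma>_def)
  qed
  have lpos: "0 < L T" using dist[of 0 T] ne T L0 Lip[of 0 T] by auto (smt (verit) zero_less_dist_iff)
  have "curve_length \<sigma> a b = ereal (b - a)" if ab: "0 \<le> a" "a \<le> b" "b \<le> L T" for a b
  proof (rule antisym)
    show "curve_length \<sigma> a b \<le> ereal (b - a)"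
    proof (rule curve_length_leI)
      fix p n assume p: "is_partition p n a b"
      have mem: "p i \<in> {0..L T}" if "i \<le> n" for i using is_partition_bounds[OF p that] ab by auto
      have "polygon_length \<sigma> p n \<le> (\<Sum>i<n. p (Suc i) - p i)"
      proof (intro sum_mono)
        fix i assume "i \<in> {..<n}"
        then have i: "p i \<in> {0..L T}" "p (Suc i) \<in> {0..L T}" "p i \<le> p (Suc i)"
          using mem[of i] mem[of "Suc i"] p by (auto simp: is_partition_def)
        then show "dist (\<sigma> (p i)) (\<sigma> (p (Suc i))) \<le> p (Suc i) - p i"
          using dist[of "\<tau> (p i)" "\<tau> (p (Suc i))"] \<tau>[OF i(1)] \<tau>[OF i(2)] by (simp add: \<sigma>_def)
      qed
      also have "\<dots> = b - a" using p by (simp add: sum_lessThan_telescope is_partition_def)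
      finally show "polygon_length \<sigma> p n \<le> b - a" .
    qed
    have ta: "\<tau> a \<in> {0..T}" "L (\<tau> a) = a" and tb: "\<tau> b \<in> {0..T}" "L (\<tau> b) = b"
      using \<tau>[of a] \<tau>[of b] ab by auto
    show "ereal (b - a) \<le> curve_length \<sigma> a b"
    proof (cases "a = b")
      case True
      have "(0::ereal) \<le> ereal (dist (\<sigma> a) (\<sigma> b))" by simp
      also have "\<dots> \<le> curve_length \<sigma> a b" by (rule dist_le_curve_length[OF ab(2)])
      finally show ?thesis using True by (simp add: zero_ereal_def)
    next
      case False
      have le: "\<tau> a \<le> \<tau> b"
        using Lip[of "\<tau> b" "\<tau> a"] ta tb ab False by (cases "\<tau> a \<le> \<tau> b") auto
      \<comment> \<open>\<open>L\<close> maps every partition of the interval from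
        \<open>\<tau> a\<close> to \<open>\<tau> b\<close> to a partition of the interval from
        \<open>a\<close> to \<open>b\<close> whose polygon on \<open>\<sigma>\<close> has the same
        vertices. Hence \<open>\<sigma>\<close> is at least as long there as \<gamma> is between the
        preimages.\<close>
      have "b - a = lip_length \<gamma> (\<tau> a) (\<tau> b)" using diff[OF _ le] ta tb by simp
      also have "ereal \<dots> = curve_length \<gamma> (\<tau> a) (\<tau> b)"
        using curve_length_eq_lip_length[OF lip le] by simp
      also have "\<dots> \<le> curve_length \<sigma> a b"
        unfolding curve_length_def[of \<gamma>]
      proof (rule SUP_least, clarsimp)
        fix p n assume q: "p 0 = \<tau> a" "p n = \<tau> b" "\<forall>i<n. p i \<le> p (Suc i)"
        then have p: "is_partition p n (\<tau> a) (\<tau> b)" by (simp add: is_partition_def)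
        have mem: "p i \<in> {0..T}" if "i \<le> n" for i
          using is_partition_bounds[OF p that] ta tb by auto
        have "is_partition (\<lambda>i. L (p i)) n a b"
          unfolding is_partition_def
        proof (intro conjI allI impI)
          show "L (p 0) = a" "L (p n) = b" using q ta tb by auto
          fix i assume "i < n"
          then show "L (p i) \<le> L (p (Suc i))" using Lip[of "p i" "p (Suc i)"] mem[of i] q by simp
        qed
        from polygon_length_le_curve_length[OF this, of \<sigma>]
        show "ereal (polygon_length \<gamma> p n) \<le> curve_length \<sigma> a b"
          using \<sigma>L mem by simp
      qed
      finally show ?thesis .
    qed
  qed
  then have "arc_length_curve \<sigma> (L T)" using lpos by (simp add: arc_length_curve_def)
  then show ?thesis using that \<sigma>L L0 Lip by blast
qed

section \<open>Measure and 1-Lipschitz maps\<close>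

lemma emeasure_lipschitz_image_le:
  fixes s :: "real \<Rightarrow> real"
  assumes lip: "lip1 s" and B: "B \<in> sets borel" and C: "C \<in> sets borel" "C \<subseteq> s ` B"
  shows "emeasure lborel C \<le> emeasure lborel B"
proof (rule ennreal_le_epsilon)
  fix e :: real assume "0 < e"
  obtain U where U: "open U" "B \<subseteq> U" "emeasure lborel (U - B) < e"
    using outer_regular_lborel[OF B \<open>0 < e\<close>] .
  have "\<exists>J. J \<in> sets borel \<and> s ` I \<subseteq> J \<and> emeasure lborel J \<le> emeasure lborel I"
    if I: "I \<in> components U" for I
  proof (cases "emeasure lborel I = \<infinity>")
    case True
    then show ?thesis by (intro exI[of _ UNIV]) auto
  next
    case False
    then obtain D where D: "emeasure lborel I = ennreal D" "0 \<le> D"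
      by (cases "emeasure lborel I") auto
    have "I \<noteq> {}" "connected I" "open I"
      using I U(1) in_components_nonempty in_components_connected open_components by blast+
    have "y - x \<le> D" if "x \<in> I" "y \<in> I" "x \<le> y" for x y
    proof -
      have "{x..y} \<subseteq> I" using \<open>connected I\<close> that by (simp add: connected_contains_Icc)
      then have "emeasure lborel {x..y} \<le> emeasure lborel I"
        using \<open>open I\<close> by (intro emeasure_mono) auto
      then show ?thesis using that D by (simp add: ennreal_le_iff)
    qed
    then have "\<bar>x - y\<bar> \<le> D" if "x \<in> I" "y \<in> I" for x y
      using that by (smt (verit))
    then have diam: "p \<le> q + D" if "p \<in> s ` I" "q \<in> s ` I" for p q
    proof -
      from that obtain x y where xy: "p = s x" "q = s y" "x \<in> I" "y \<in> I" by blast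
      then have "\<bar>x - y\<bar> \<le> D" using \<open>\<And>x y. \<lbrakk>x \<in> I; y \<in> I\<rbrakk> \<Longrightarrow> \<bar>x - y\<bar> \<le> D\<close> by blast
      then show ?thesis using lip1D[OF lip, of x y] xy by (simp add: dist_real_def)
    qed
    obtain q where q: "q \<in> s ` I" using \<open>I \<noteq> {}\<close> by auto
    have bdd: "bdd_above (s ` I)" "bdd_below (s ` I)"
      using diam[OF _ q] diam[OF q] unfolding bdd_above_def bdd_below_def
      by (blast, metis diff_le_eq)
    have "Sup (s ` I) \<le> Inf (s ` I) + D"
    proof (intro cSup_least)
      fix p assume "p \<in> s ` I"
      then have "p - D \<le> Inf (s ` I)" using diam \<open>I \<noteq> {}\<close> by (intro cInf_greatest) (auto simp: diff_le_eq)
      then show "p \<le> Inf (s ` I) + D" by simp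
    qed (use \<open>I \<noteq> {}\<close> in auto)
    moreover have "s ` I \<subseteq> {Inf (s ` I)..Sup (s ` I)}"
      using bdd by (meson atLeastAtMost_iff cInf_lower cSup_upper subsetI)
    moreover have "Inf (s ` I) \<le> Sup (s ` I)" using bdd q by (meson cInf_lower cSup_upper order_trans)
    ultimately show ?thesis
      using D by (intro exI[of _ "{Inf (s ` I)..Sup (s ` I)}"]) (auto intro!: ennreal_leI)
  qed
  then obtain J where J: "\<And>I. I \<in> components U \<Longrightarrow> J I \<in> sets borel \<and> s ` I \<subseteq> J I \<and> emeasure lborel (J I) \<le> emeasure lborel I"
    by metis
  have pw: "pairwise disjnt (components U)" using pairwise_disjoint_components[of U] by (simp add: pairwise_def disjnt_def)
  have cnt: "countable (components U)"
    using countable_disjoint_open_subsets[OF _ pw] U(1) open_components by blast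
  \<comment> \<open>The components are listed over all naturals, with the empty set outside
    \<open>S\<close>, so that finitely many components need no separate treatment.\<close>
  define S where "S = to_nat_on (components U) ` components U"
  define f where "f n = (if n \<in> S then from_nat_into (components U) n else {})" for n
  define F where "F n = (if n \<in> S then J (f n) else {})" for n
  have f: "f n \<in> components U" if "n \<in> S" for n
    using that cnt by (auto simp: f_def S_def)
  have f_to: "f (to_nat_on (components U) I) = I" if "I \<in> components U" for I
    using that cnt by (auto simp: f_def S_def)
  have "inj_on f S" using cnt by (auto simp: inj_on_def f_def S_def)
  then have disj: "disjoint_family f"
    using f pw unfolding disjoint_family_on_def pairwise_def disjnt_def inj_on_def
    by (metis Int_empty_left Int_empty_right f_def)
  have fo: "f n \<in> sets borel" for n
    using f[of n] open_components[OF U(1)] by (cases "n \<in> S") (auto simp: f_def)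
  have UF: "U = (\<Union>n. f n)"
  proof -
    have "f n \<subseteq> U" for n
      using in_components_subset[OF f[of n]] by (cases "n \<in> S") (auto simp: f_def)
    moreover have "U \<subseteq> (\<Union>n. f n)"
    proof
      fix x assume "x \<in> U"
      then obtain I where "I \<in> components U" "x \<in> I" using Union_components[of U] by blast
      then show "x \<in> (\<Union>n. f n)" using f_to by blast
    qed
    ultimately show ?thesis by blast
  qed
  have CF: "C \<subseteq> (\<Union>n. F n)"
  proof
    fix y assume "y \<in> C"
    then obtain x where "y = s x" "x \<in> U" using C U by auto
    then obtain n where n: "x \<in> f n" using UF by auto
    then have "n \<in> S" by (auto simp: f_def split: if_splits)
    then show "y \<in> (\<Union>n. F n)" using n \<open>y = s x\<close> J[OF f[OF \<open>n \<in> S\<close>]] by (auto simp: F_def)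
  qed
  have F: "F n \<in> sets borel" "emeasure lborel (F n) \<le> emeasure lborel (f n)" for n
    using J[OF f[of n]] by (auto simp: F_def)
  have "emeasure lborel C \<le> emeasure lborel (\<Union>n. F n)"
    using F CF by (intro emeasure_mono) auto
  also have "\<dots> \<le> (\<Sum>n. emeasure lborel (F n))"
    using F by (intro emeasure_subadditive_countably) auto
  also have "\<dots> \<le> (\<Sum>n. emeasure lborel (f n))"
    using F by (intro suminf_le) auto
  also have "\<dots> = emeasure lborel U"
    using fo disj UF by (subst suminf_emeasure) auto
  also have "\<dots> \<le> emeasure lborel (B \<union> (U - B))" using U by (intro emeasure_mono) (use B in auto)
  also have "\<dots> \<le> emeasure lborel B + emeasure lborel (U - B)" using U B by (intro emeasure_subadditive) auto
  also have "\<dots> \<le> emeasure lborel B + e" using U(3) by (intro add_left_mono) auto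
  finally show "emeasure lborel C \<le> emeasure lborel B + e" .
qed

text \<open>By the intermediate value theorem \<open>s\<close> maps \<open>{0..T}\<close> onto a
  superset of \<open>{0..l}\<close>. The preceding lemma then says that Lebesgue measure on
  \<open>{0..l}\<close> is dominated by the image under \<open>s\<close> of Lebesgue measure on
  \<open>{0..T}\<close>, and the integrals compare accordingly.\<close>

lemma nn_integral_lipschitz_substitution_le:
  fixes s :: "real \<Rightarrow> real" and f :: "real \<Rightarrow> ennreal"
  assumes lip: "lip1 s" and T: "0 \<le> T" and s: "s 0 = 0" "s T = l"
    and [measurable]: "f \<in> borel_measurable borel"
  shows "(\<integral>\<^sup>+ r. f r * indicator {0..l} r \<partial>lborel) \<le> (\<integral>\<^sup>+ t. f (s t) * indicator {0..T} t \<partial>lborel)"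
proof -
  have [measurable]: "s \<in> borel_measurable borel" using lip by (rule lip1_measurable)
  have sub: "{0..l} \<subseteq> s ` {0..T}"
  proof
    fix r assume "r \<in> {0..l}"
    then show "r \<in> s ` {0..T}"
      using IVT'[of s 0 r T] s T lipschitz_on_continuous_on[OF lip] continuous_on_subset by fastforce
  qed
  define \<mu> where "\<mu> = density lborel (indicator {0..l} :: real \<Rightarrow> ennreal)"
  define \<nu> where "\<nu> = distr (density lborel (indicator {0..T} :: real \<Rightarrow> ennreal)) borel s"
  have "\<mu> \<le> \<nu>"
  proof (subst le_measure)
    show "sets \<mu> = sets \<nu>" by (simp add: \<mu>_def \<nu>_def)
    show "\<forall>A\<in>sets \<mu>. emeasure \<mu> A \<le> emeasure \<nu> A"
    proof
      fix A assume "A \<in> sets \<mu>"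
      then have [measurable]: "A \<in> sets borel" by (simp add: \<mu>_def)
      have [measurable]: "s -` A \<in> sets borel"
        using measurable_sets[OF \<open>s \<in> borel_measurable borel\<close> \<open>A \<in> sets borel\<close>] by simp
      have "emeasure \<mu> A = emeasure lborel ({0..l} \<inter> A)"
        by (simp add: \<mu>_def emeasure_density indicator_inter_arith[symmetric])
      also have "\<dots> \<le> emeasure lborel ({0..T} \<inter> s -` A)"
        using sub by (intro emeasure_lipschitz_image_le[OF lip]) auto
      also have "\<dots> = emeasure \<nu> A"
        by (simp add: \<nu>_def emeasure_distr emeasure_density indicator_inter_arith[symmetric])
      finally show "emeasure \<mu> A \<le> emeasure \<nu> A" .
    qed
  qed
  then have "nn_integral \<mu> f \<le> nn_integral \<nu> f"
    by (intro nn_integral_mono_measure) (auto simp: \<mu>_def \<nu>_def)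
  then show ?thesis
    by (simp add: \<mu>_def \<nu>_def nn_integral_density nn_integral_distr mult.commute)
qed

section \<open>Line integrals and infima over curves\<close>

lemma line_integral_cong:
  "(\<And>t. t \<in> {0..l} \<Longrightarrow> \<gamma> t = \<sigma> t) \<Longrightarrow> line_integral g \<gamma> l = line_integral g \<sigma> l"
  unfolding line_integral_def by (intro nn_integral_cong) (auto split: split_indicator)

lemma line_integral_mono:
  "(\<And>x. f x \<le> g x) \<Longrightarrow> line_integral f \<gamma> l \<le> line_integral g \<gamma> l"
  unfolding line_integral_def by (intro nn_integral_mono mult_right_mono) auto

lemma line_integral_mono_time:
  "s \<le> t \<Longrightarrow> line_integral g \<gamma> s \<le> line_integral g \<gamma> t"
  unfolding line_integral_def by (intro nn_integral_mono) (auto split: split_indicator)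

lemma line_integral_0 [simp]: "line_integral g \<gamma> 0 = 0"
proof -
  have "line_integral g \<gamma> 0 = (\<integral>\<^sup>+ t. g (\<gamma> 0) * indicator {0} (t::real) \<partial>lborel)"
    unfolding line_integral_def by (rule nn_integral_cong) (auto split: split_indicator)
  then show ?thesis by (simp add: nn_integral_cmult_indicator)
qed

lemma line_integral_cmult:
  assumes "lip1 \<gamma>" and [measurable]: "g \<in> borel_measurable borel"
  shows "line_integral (\<lambda>x. a * g x) \<gamma> l = a * line_integral g \<gamma> l"
proof -
  have [measurable]: "\<gamma> \<in> borel_measurable borel" using assms(1) by (rule lip1_measurable)
  show ?thesis unfolding line_integral_def by (simp add: mult.assoc nn_integral_cmult)
qed

lemma line_integral_add:
  assumes "lip1 \<gamma>" and [measurable]: "f \<in> borel_measurable borel" "g \<in> borel_measurable borel"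
  shows "line_integral (\<lambda>x. f x + g x) \<gamma> l = line_integral f \<gamma> l + line_integral g \<gamma> l"
proof -
  have [measurable]: "\<gamma> \<in> borel_measurable borel" using assms(1) by (rule lip1_measurable)
  show ?thesis unfolding line_integral_def by (simp add: distrib_right nn_integral_add)
qed

lemma line_integral_reverse:
  assumes "lip1 \<gamma>" and [measurable]: "g \<in> borel_measurable borel"
  shows "line_integral g (\<lambda>t. \<gamma> (T - t)) T = line_integral g \<gamma> T"
proof -
  have [measurable]: "\<gamma> \<in> borel_measurable borel" using assms(1) by (rule lip1_measurable)
  have "line_integral g \<gamma> T = (\<integral>\<^sup>+ t. g (\<gamma> (T - t)) * indicator {0..T} (T - t) \<partial>lborel)"
    unfolding line_integral_def by (subst nn_integral_real_affine[where c = "-1" and t = T]) auto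
  also have "\<dots> = line_integral g (\<lambda>t. \<gamma> (T - t)) T"
    unfolding line_integral_def by (intro nn_integral_cong) (auto split: split_indicator)
  finally show ?thesis by simp
qed

lemma lip1_reverse: "lip1 \<gamma> \<Longrightarrow> lip1 (\<lambda>t. \<gamma> (T - t))"
proof (rule lip1I)
  fix s t :: real assume "lip1 \<gamma>" "s \<le> t"
  then show "dist (\<gamma> (T - s)) (\<gamma> (T - t)) \<le> t - s" using lip1D[of \<gamma> "T - s" "T - t"] by simp
qed

lemma lip1_join:
  assumes "lip1 \<gamma>" "lip1 \<sigma>" "\<gamma> T = \<sigma> 0"
  shows "lip1 (\<lambda>t. if t \<le> T then \<gamma> t else \<sigma> (t - T))"
proof (rule lip1I)
  fix s t :: real assume "s \<le> t"
  then show "dist (if s \<le> T then \<gamma> s else \<sigma> (s - T)) (if t \<le> T then \<gamma> t else \<sigma> (t - T)) \<le> t - s"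
    using lip1D[OF assms(1), of s t] lip1D[OF assms(1), of s T] lip1D[OF assms(2), of 0 "t - T"]
      lip1D[OF assms(2), of "s - T" "t - T"] dist_triangle[of "\<gamma> s" "\<sigma> (t - T)" "\<gamma> T"] assms(3)
    by auto
qed

lemma line_integral_join_le:
  assumes "lip1 \<gamma>" "lip1 \<sigma>" "0 \<le> T" "0 \<le> S" and [measurable]: "g \<in> borel_measurable borel"
  shows "line_integral g (\<lambda>t. if t \<le> T then \<gamma> t else \<sigma> (t - T)) (T + S)
    \<le> line_integral g \<gamma> T + line_integral g \<sigma> S"
proof -
  have [measurable]: "\<gamma> \<in> borel_measurable borel" "\<sigma> \<in> borel_measurable borel"
    using assms by (auto intro: lip1_measurable)
  have "line_integral g (\<lambda>t. if t \<le> T then \<gamma> t else \<sigma> (t - T)) (T + S)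
      \<le> (\<integral>\<^sup>+ t. g (\<gamma> t) * indicator {0..T} t + g (\<sigma> (t - T)) * indicator {0..S} (t - T) \<partial>lborel)"
    unfolding line_integral_def by (intro nn_integral_mono) (auto split: split_indicator)
  also have "\<dots> = line_integral g \<gamma> T + (\<integral>\<^sup>+ t. g (\<sigma> (t - T)) * indicator {0..S} (t - T) \<partial>lborel)"
    unfolding line_integral_def by (simp add: nn_integral_add)
  also have "(\<integral>\<^sup>+ t. g (\<sigma> (t - T)) * indicator {0..S} (t - T) \<partial>lborel) = line_integral g \<sigma> S"
    unfolding line_integral_def by (subst nn_integral_real_affine[where c = 1 and t = T]) auto
  finally show ?thesis .
qed

text \<open>An arc-length curve is constrained only on its parameter interval. Clamping the
  parameter turns it into a 1-Lipschitz map on the whole line without changing it on that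
  interval.\<close>

lemma arc_length_curve_lip1:
  assumes "arc_length_curve \<sigma> l"
  shows "lip1 (\<lambda>r. \<sigma> (max 0 (min l r)))"
proof (rule lip1I)
  fix s t :: real assume "s \<le> t"
  define s' t' where "s' = max 0 (min l s)" and "t' = max 0 (min l t)"
  have *: "0 \<le> s'" "s' \<le> t'" "t' \<le> l" "t' - s' \<le> t - s"
    using \<open>s \<le> t\<close> assms by (auto simp: s'_def t'_def arc_length_curve_def)
  then have "ereal (dist (\<sigma> s') (\<sigma> t')) \<le> ereal (t' - s')"
    using dist_le_curve_length[of s' t' \<sigma>] assms by (simp add: arc_length_curve_def)
  then show "dist (\<sigma> s') (\<sigma> t') \<le> t - s" using * by simp
qed

text \<open>Upper gradients of functions with values in [0, infinity], in additive form to avoid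
  subtraction. Unlike with \<open>ediff\<close>, two infinite end values impose no condition on the
  line integral.\<close>

definition upper_grad :: "('a::metric_space \<Rightarrow> ennreal) \<Rightarrow> ('a \<Rightarrow> ennreal) \<Rightarrow> bool" where
  "upper_grad g w \<longleftrightarrow> g \<in> borel_measurable borel \<and>
     (\<forall>\<gamma> l. arc_length_curve \<gamma> l \<longrightarrow>
        w (\<gamma> 0) \<le> w (\<gamma> l) + line_integral g \<gamma> l \<and> w (\<gamma> l) \<le> w (\<gamma> 0) + line_integral g \<gamma> l)"

text \<open>Reparametrize \<gamma> by arc length. The length function is 1-Lipschitz in the
  parameter, so by the substitution inequality the line integral over the arc-length curve is at
  most the one over \<gamma>. If the end points agree there may be no arc-length curve, but then the
  claim is trivial.\<close>

lemma upper_grad_lip1: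
  assumes upper_grad: "upper_grad g w" and lip: "lip1 \<gamma>" and T: "0 \<le> T"
  shows "w (\<gamma> 0) \<le> w (\<gamma> T) + line_integral g \<gamma> T"
proof (cases "\<gamma> 0 = \<gamma> T")
  case False
  have [measurable]: "g \<in> borel_measurable borel" using upper_grad by (simp add: upper_grad_def)
  define L where "L = lip_length \<gamma> 0"
  obtain \<sigma> where \<sigma>: "arc_length_curve \<sigma> (L T)" "\<And>t. t \<in> {0..T} \<Longrightarrow> \<sigma> (L t) = \<gamma> t" and L0: "L 0 = 0"
    and L: "\<And>s t. 0 \<le> s \<Longrightarrow> s \<le> t \<Longrightarrow> L s \<le> L t \<and> L t - L s \<le> t - s"
    using arc_length_reparametrization[OF lip T False] unfolding L_def by metis
  \<comment> \<open>\<open>\<rho>\<close> and \<open>s\<close> extend \<open>\<sigma>\<close> and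
    \<open>L\<close> to the whole line, as the measurability and Lipschitz statements require; on
    the relevant intervals nothing changes.\<close>
  define \<rho> where "\<rho> r = \<sigma> (max 0 (min (L T) r))" for r
  define s where "s t = L (max 0 t)" for t
  have [measurable]: "\<rho> \<in> borel_measurable borel"
    unfolding \<rho>_def using arc_length_curve_lip1[OF \<sigma>(1)] by (rule lip1_measurable)
  have s: "lip1 s"
  proof (rule lip1I)
    fix a b :: real assume "a \<le> b"
    then show "dist (s a) (s b) \<le> b - a"
      using L[of "max 0 a" "max 0 b"] by (auto simp: s_def dist_real_def max_def split: if_splits)
  qed
  have "line_integral g \<sigma> (L T) = line_integral g \<rho> (L T)"
    by (intro line_integral_cong) (auto simp: \<rho>_def)
  also have "\<dots> \<le> (\<integral>\<^sup>+ t. g (\<rho> (s t)) * indicator {0..T} t \<partial>lborel)"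
    unfolding line_integral_def
    by (intro nn_integral_lipschitz_substitution_le s T) (use T L0 in \<open>auto simp: s_def\<close>)
  also have "\<dots> = line_integral g \<gamma> T"
    unfolding line_integral_def
  proof (intro nn_integral_cong)
    fix t
    have "\<rho> (s t) = \<gamma> t" if "t \<in> {0..T}"
      using L[of 0 t] L[of t T] L0 \<sigma>(2)[OF that] that by (simp add: \<rho>_def s_def)
    then show "g (\<rho> (s t)) * indicator {0..T} t = g (\<gamma> t) * indicator {0..T} t"
      by (auto split: split_indicator)
  qed
  finally have le: "line_integral g \<sigma> (L T) \<le> line_integral g \<gamma> T" .
  have "w (\<sigma> 0) \<le> w (\<sigma> (L T)) + line_integral g \<sigma> (L T)"
    using upper_grad \<sigma>(1) by (auto simp: upper_grad_def)
  also have "\<dots> \<le> w (\<sigma> (L T)) + line_integral g \<gamma> T" using le by (rule add_left_mono)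
  finally show ?thesis using \<sigma>(2)[of 0] \<sigma>(2)[of T] T L0 by simp
qed simp

text \<open>1-Lipschitz curves on all of \<open>\<real>\<close> are used in place of arc-length curves because they are closed under
  pointwise limits and concatenation; \<open>arc_length_reparametrization\<close> translates between the two.\<close>

definition curve_inf :: "('a::metric_space \<Rightarrow> ennreal) \<Rightarrow> ('a \<Rightarrow> ennreal) \<Rightarrow> 'a \<Rightarrow> ennreal" where
  "curve_inf h g x = (INF p \<in> {(\<gamma>, T). lip1 \<gamma> \<and> 0 \<le> T \<and> \<gamma> 0 = x}.
     h (fst p (snd p)) + line_integral g (fst p) (snd p))"

lemma curve_inf_lower: "lip1 \<gamma> \<Longrightarrow> 0 \<le> T \<Longrightarrow> curve_inf h g (\<gamma> 0) \<le> h (\<gamma> T) + line_integral g \<gamma> T"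
  unfolding curve_inf_def by (rule INF_lower2[of "(\<gamma>, T)"]) auto

lemma curve_inf_greatest:
  "(\<And>\<gamma> T. lip1 \<gamma> \<Longrightarrow> 0 \<le> T \<Longrightarrow> \<gamma> 0 = x \<Longrightarrow> c \<le> h (\<gamma> T) + line_integral g \<gamma> T) \<Longrightarrow> c \<le> curve_inf h g x"
  unfolding curve_inf_def by (rule INF_greatest) auto

lemma curve_inf_lessD:
  assumes "curve_inf h g x < c"
  obtains \<gamma> T where "lip1 \<gamma>" "0 \<le> T" "\<gamma> 0 = x" "h (\<gamma> T) + line_integral g \<gamma> T < c"
  using assms unfolding curve_inf_def INF_less_iff by auto

lemma curve_inf_le: "curve_inf h g x \<le> h x"
  using curve_inf_lower[of "\<lambda>_. x" 0 h g] lip1I[of "\<lambda>_. x"] by simp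

text \<open>Running first along \<gamma> and then along any competitor that starts at
  \<open>\<gamma> T\<close> gives a competitor for \<open>\<gamma> 0\<close>.\<close>

lemma curve_inf_along_curve:
  fixes \<gamma> :: "real \<Rightarrow> 'a::metric_space"
  assumes "lip1 \<gamma>" "0 \<le> T" "g \<in> borel_measurable borel"
  shows "curve_inf h g (\<gamma> 0) \<le> line_integral g \<gamma> T + curve_inf h g (\<gamma> T)"
proof -
  \<comment> \<open>Subtracting the line integral, if finite, turns the claim into a lower bound for
    the cost of every competitor at \<open>\<gamma> T\<close>.\<close>
  have "curve_inf h g (\<gamma> 0) - line_integral g \<gamma> T \<le> curve_inf h g (\<gamma> T)" if fin: "line_integral g \<gamma> T \<noteq> top"
  proof (rule curve_inf_greatest)
    fix \<sigma> :: "real \<Rightarrow> 'a" and S :: real assume \<sigma>: "lip1 \<sigma>" "0 \<le> S" "\<sigma> 0 = \<gamma> T"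
    define \<rho> where "\<rho> t = (if t \<le> T then \<gamma> t else \<sigma> (t - T))" for t
    have \<rho>: "lip1 \<rho>" unfolding \<rho>_def using assms \<sigma> by (intro lip1_join) auto
    have "curve_inf h g (\<rho> 0) \<le> h (\<rho> (T + S)) + line_integral g \<rho> (T + S)"
      using assms \<sigma> by (intro curve_inf_lower \<rho>) auto
    also have "\<dots> \<le> h (\<rho> (T + S)) + (line_integral g \<gamma> T + line_integral g \<sigma> S)"
      unfolding \<rho>_def using assms \<sigma> by (intro add_left_mono line_integral_join_le) auto
    finally have "curve_inf h g (\<gamma> 0) \<le> h (\<sigma> S) + (line_integral g \<gamma> T + line_integral g \<sigma> S)"
      using assms(2) \<sigma> by (auto simp: \<rho>_def split: if_splits)
    then show "curve_inf h g (\<gamma> 0) - line_integral g \<gamma> T \<le> h (\<sigma> S) + line_integral g \<sigma> S"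
      using fin by (simp add: ennreal_minus_le_iff ac_simps)
  qed
  then show ?thesis by (cases "line_integral g \<gamma> T = top") (auto simp: ennreal_minus_le_iff)
qed

lemma min_1_le_add:
  fixes a b i :: ennreal
  assumes "a \<le> i + b"
  shows "min 1 a \<le> min 1 b + i"
proof (cases "1 \<le> b")
  case True
  then have "min 1 a \<le> min 1 b" by simp
  then show ?thesis by (meson add_increasing2 zero_le)
next
  case False
  then show ?thesis using assms by (simp add: min.coboundedI2 add.commute)
qed

text \<open>One inequality is \<open>curve_inf_along_curve\<close>, the other is the same for the
  reversed curve. Truncation at 1 keeps the values finite, as
  \<open>upper_gradient_of_upper_grad\<close> demands.\<close>

lemma upper_grad_min_1_curve_inf:
  fixes h g :: "'a::metric_space \<Rightarrow> ennreal"
  assumes [measurable]: "g \<in> borel_measurable borel"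
  shows "upper_grad g (\<lambda>x. min 1 (curve_inf h g x))"
  unfolding upper_grad_def
proof (intro conjI allI impI)
  fix \<gamma> :: "real \<Rightarrow> 'a" and l :: real assume arc: "arc_length_curve \<gamma> l"
  define \<sigma> where "\<sigma> r = \<gamma> (max 0 (min l r))" for r
  have l: "0 \<le> l" using arc by (simp add: arc_length_curve_def)
  have \<sigma>: "lip1 \<sigma>" unfolding \<sigma>_def using arc by (rule arc_length_curve_lip1)
  have eq: "line_integral g \<gamma> l = line_integral g \<sigma> l" "\<gamma> 0 = \<sigma> 0" "\<gamma> l = \<sigma> l"
    using l by (auto simp: \<sigma>_def intro!: line_integral_cong)
  show "min 1 (curve_inf h g (\<gamma> 0)) \<le> min 1 (curve_inf h g (\<gamma> l)) + line_integral g \<gamma> l"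
    unfolding eq by (intro min_1_le_add curve_inf_along_curve \<sigma> l assms)
  show "min 1 (curve_inf h g (\<gamma> l)) \<le> min 1 (curve_inf h g (\<gamma> 0)) + line_integral g \<gamma> l"
    unfolding eq using curve_inf_along_curve[OF lip1_reverse[OF \<sigma>, of l] l assms, of h]
    by (intro min_1_le_add) (simp add: line_integral_reverse[OF \<sigma>])
qed (rule assms)

text \<open>The upper gradient inequality, scaled by \<open>a\<close>, bounds the cost of every
  single competitor from below.\<close>

lemma curve_inf_ge_of_upper_grad:
  fixes w :: "'a::metric_space \<Rightarrow> ennreal"
  assumes upper_grad: "upper_grad g w" and "\<And>x. a * w x \<le> h x" "\<And>x. a * g x \<le> k x"
  shows "a * w x \<le> curve_inf h k x"
proof (rule curve_inf_greatest)
  fix \<gamma> :: "real \<Rightarrow> 'a" and T :: real assume \<gamma>: "lip1 \<gamma>" "0 \<le> T" "\<gamma> 0 = x"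
  have g: "g \<in> borel_measurable borel" using upper_grad by (simp add: upper_grad_def)
  have "a * w x \<le> a * (w (\<gamma> T) + line_integral g \<gamma> T)"
    using upper_grad_lip1[OF upper_grad \<gamma>(1,2)] \<gamma>(3) by (intro mult_left_mono) auto
  also have "\<dots> = a * w (\<gamma> T) + line_integral (\<lambda>x. a * g x) \<gamma> T"
    by (simp add: distrib_left line_integral_cmult[OF \<gamma>(1) g])
  also have "\<dots> \<le> h (\<gamma> T) + line_integral k \<gamma> T"
    by (intro add_mono line_integral_mono assms)
  finally show "a * w x \<le> h (\<gamma> T) + line_integral k \<gamma> T" .
qed

section \<open>Lower semicontinuity of infima over curves\<close>

definition lsc_ennreal :: "('a::topological_space \<Rightarrow> ennreal) \<Rightarrow> bool" where
  "lsc_ennreal f \<longleftrightarrow> (\<forall>t. open {x. t < f x})"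

lemma lsc_ennreal_measurable [measurable]: "lsc_ennreal f \<Longrightarrow> f \<in> borel_measurable borel"
  by (rule borel_measurableI_greater) (simp add: lsc_ennreal_def)

lemma lsc_ennreal_closed: "lsc_ennreal f \<Longrightarrow> closed {x. f x \<le> t}"
  unfolding closed_def lsc_ennreal_def by (simp add: Compl_eq not_le)

lemma lsc_ennreal_eventually:
  assumes "lsc_ennreal f" "(xs \<longlongrightarrow> x) F" "t < f x"
  shows "\<forall>\<^sub>F n in F. t < f (xs n)"
  using topological_tendstoD[OF assms(2), of "{x. t < f x}"] assms by (auto simp: lsc_ennreal_def)

lemma lsc_ennreal_indicator:
  assumes f: "lsc_ennreal f" and U: "open U"
  shows "lsc_ennreal (\<lambda>x. f x * indicator U x)"
  unfolding lsc_ennreal_def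
proof
  fix t
  have "{x. t < f x * indicator U x} = {x. t < f x} \<inter> U"
    by (auto split: split_indicator_asm split_indicator)
  then show "open {x. t < f x * indicator U x}" using f U by (auto simp: lsc_ennreal_def)
qed

text \<open>The Arzela-Ascoli argument: a diagonal subsequence converges at all rational times, and
  the common Lipschitz constant with the completeness of \<open>K\<close> extends the convergence to
  all times.\<close>

lemma lip1_compact_subsequence:
  fixes \<gamma> :: "nat \<Rightarrow> real \<Rightarrow> 'a::metric_space"
  assumes lip: "\<And>n. lip1 (\<gamma> n)" and K: "compact K" and mem: "\<And>n t. \<gamma> n t \<in> K"
  obtains r \<sigma> where "strict_mono r" "lip1 \<sigma>" "\<And>t. (\<lambda>n. \<gamma> (r n) t) \<longlonglongrightarrow> \<sigma> t"
proof -
  define q where "q n = real_of_rat (nat_to_rat_surj n)" for n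
  interpret subseqs "\<lambda>n s. convergent (\<lambda>k. \<gamma> (s k) (q n))"
  proof
    fix n and s :: "nat \<Rightarrow> nat"
    have "\<forall>k. \<gamma> (s k) (q n) \<in> K" by (simp add: mem)
    then obtain l r where "strict_mono r" "((\<lambda>k. \<gamma> (s k) (q n)) \<circ> r) \<longlonglongrightarrow> l"
      using K unfolding compact_def by metis
    then show "\<exists>r'. strict_mono r' \<and> convergent (\<lambda>k. \<gamma> ((s \<circ> r') k) (q n))"
      by (auto simp: convergent_def o_def)
  qed
  have conv: "convergent (\<lambda>k. \<gamma> (diagseq k) (q n))" for n
  proof -
    have "convergent (\<lambda>k. \<gamma> ((diagseq \<circ> (+) (Suc n)) k) (q n))"
    proof (rule diagseq_holds)
      fix r s :: "nat \<Rightarrow> nat" and n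
      assume "strict_mono r" "convergent (\<lambda>k. \<gamma> (s k) (q n))"
      then show "convergent (\<lambda>k. \<gamma> ((s \<circ> r) k) (q n))"
        using convergent_subseq_convergent[of "\<lambda>k. \<gamma> (s k) (q n)" r] by (simp add: o_def)
    qed
    then show ?thesis
      using convergent_ignore_initial_segment[of "\<lambda>k. \<gamma> (diagseq k) (q n)" "Suc n"]
      by (simp add: o_def add.commute)
  qed
  have "\<exists>l. (\<lambda>k. \<gamma> (diagseq k) t) \<longlonglongrightarrow> l" for t
  proof -
    have "Cauchy (\<lambda>k. \<gamma> (diagseq k) t)"
    proof (rule metric_CauchyI)
      fix e :: real assume "0 < e"
      \<comment> \<open>At a rational time within \<open>e/4\<close> of \<open>t\<close>, two
        Lipschitz errors and the Cauchy error at \<open>a\<close> add up to less than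
        \<open>3 * e/4\<close>.\<close>
      obtain a where a: "a \<in> \<rat>" "t < a" "a < t + e/4" using Rats_dense_in_real[of t "t + e/4"] \<open>0 < e\<close> by auto
      then obtain n where n: "a = q n"
        by (metis Rats_cases q_def surjD surj_nat_to_rat_surj)
      obtain M where M: "\<And>j k. j \<ge> M \<Longrightarrow> k \<ge> M \<Longrightarrow> dist (\<gamma> (diagseq j) a) (\<gamma> (diagseq k) a) < e/4"
        using convergent_Cauchy[OF conv[of n]] \<open>0 < e\<close> unfolding n Cauchy_def
        by (metis zero_less_divide_iff zero_less_numeral)
      have "dist (\<gamma> (diagseq j) t) (\<gamma> (diagseq k) t) < e" if "j \<ge> M" "k \<ge> M" for j k
        using M[OF that] lip1D[OF lip, of "diagseq j" t a] lip1D[OF lip, of "diagseq k" t a] a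
          dist_triangle[of "\<gamma> (diagseq j) t" "\<gamma> (diagseq k) t" "\<gamma> (diagseq j) a"]
          dist_triangle[of "\<gamma> (diagseq j) a" "\<gamma> (diagseq k) t" "\<gamma> (diagseq k) a"]
          dist_commute[of "\<gamma> (diagseq k) t" "\<gamma> (diagseq k) a"]
        by linarith
      then show "\<exists>M. \<forall>m\<ge>M. \<forall>n\<ge>M. dist (\<gamma> (diagseq m) t) (\<gamma> (diagseq n) t) < e" by blast
    qed
    moreover have "\<forall>k. \<gamma> (diagseq k) t \<in> K" using mem by simp
    moreover have "\<forall>f. (\<forall>n. f n \<in> K) \<and> Cauchy f \<longrightarrow> (\<exists>l\<in>K. f \<longlonglongrightarrow> l)"
      using compact_imp_complete[OF K] unfolding complete_def .
    ultimately show ?thesis by metis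
  qed
  then obtain \<sigma> where \<sigma>: "\<And>t. (\<lambda>k. \<gamma> (diagseq k) t) \<longlonglongrightarrow> \<sigma> t" by metis
  have "lip1 \<sigma>"
  proof (rule lip1I)
    fix s t :: real assume "s \<le> t"
    show "dist (\<sigma> s) (\<sigma> t) \<le> t - s"
      by (rule LIMSEQ_le_const2[OF tendsto_dist[OF \<sigma> \<sigma>]]) (use lip1D[OF lip, of _ s t] \<open>s \<le> t\<close> in auto)
  qed
  then show ?thesis using that[OF subseq_diagseq _ \<sigma>] by blast
qed

text \<open>Meant for cutting a curve at its first entry into the closed set where \<open>h\<close>
  is at most \<epsilon>. There the end cost is small, and before it \<open>h\<close> exceeds
  \<epsilon>, which will bound the length.\<close>

lemma first_hit:
  assumes lip: "lip1 \<gamma>" and T: "0 \<le> T" and h: "lsc_ennreal h"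
  obtains T' where "0 \<le> T'" "T' \<le> T" "\<And>s. 0 \<le> s \<Longrightarrow> s < T' \<Longrightarrow> \<epsilon> < h (\<gamma> s)"
    "T' = T \<or> h (\<gamma> T') \<le> \<epsilon>"
proof (cases "\<exists>s\<in>{0..T}. h (\<gamma> s) \<le> \<epsilon>")
  case True
  define Z where "Z = {0..T} \<inter> \<gamma> -` {x. h x \<le> \<epsilon>}"
  have "compact Z" unfolding Z_def
    by (intro compact_Int_closed closed_vimage lsc_ennreal_closed h lipschitz_on_continuous_on[OF lip]) auto
  moreover have "Z \<noteq> {}" using True by (auto simp: Z_def)
  ultimately obtain T' where T': "T' \<in> Z" "\<forall>s\<in>Z. T' \<le> s" using compact_attains_inf by blast
  show ?thesis
  proof (rule that[of T'])
    fix s assume s: "0 \<le> s" "s < T'"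
    then have "s \<notin> Z" using T' by auto
    then show "\<epsilon> < h (\<gamma> s)" using s T' by (auto simp: Z_def)
  qed (use T' in \<open>auto simp: Z_def\<close>)
next
  case False
  then show ?thesis using T by (intro that[of T]) (auto simp: not_le)
qed

text \<open>Lower semicontinuity of \<open>h\<close> and \<open>g\<close> bounds the end term and
  the integrand of the limit curve by the lower limits along the sequence; Fatou's lemma does the
  rest.\<close>

lemma curve_cost_le_of_tendsto:
  fixes h g :: "'a::metric_space \<Rightarrow> ennreal"
  assumes h: "lsc_ennreal h" and g: "lsc_ennreal g" and lip: "\<And>n. lip1 (u n)" "lip1 \<sigma>"
    and conv: "\<And>t. (\<lambda>n. u n t) \<longlonglongrightarrow> \<sigma> t" and T: "\<tau> \<longlonglongrightarrow> T"
    and le: "\<And>n. h (u n (\<tau> n)) + line_integral g (u n) (\<tau> n) \<le> c"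
  shows "h (\<sigma> T) + line_integral g \<sigma> T \<le> c"
proof -
  have [measurable]: "g \<in> borel_measurable borel" using g by (rule lsc_ennreal_measurable)
  have [measurable]: "u n \<in> borel_measurable borel" "\<sigma> \<in> borel_measurable borel" for n
    using lip by (auto intro: lip1_measurable)
  \<comment> \<open>The end term is spread over an interval of length 1, so that Fatou's lemma applies to the whole cost.\<close>
  define f where "f n t = g (u n t) * indicator {0..\<tau> n} t + h (u n (\<tau> n)) * indicator {-2..-1} t" for n t
  have [measurable]: "f n \<in> borel_measurable borel" for n unfolding f_def by measurable
  have one: "(\<integral>\<^sup>+ t. a * indicator {-2..-1::real} t \<partial>lborel) = a" for a :: ennreal
    by (simp add: nn_integral_cmult)
  \<comment> \<open>The moving time costs at most its distance to \<open>T\<close> because the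
    curves are 1-Lipschitz.\<close>
  have "(\<lambda>n. u n (\<tau> n)) \<longlonglongrightarrow> \<sigma> T"
  proof -
    have "(\<lambda>n. dist (u n (\<tau> n)) (\<sigma> T)) \<longlonglongrightarrow> 0"
    proof (rule tendsto_sandwich[where f = "\<lambda>_. 0" and h = "\<lambda>n. dist (\<tau> n) T + dist (u n T) (\<sigma> T)"])
      have "dist (u n (\<tau> n)) (\<sigma> T) \<le> dist (\<tau> n) T + dist (u n T) (\<sigma> T)" for n
        using dist_triangle[of "u n (\<tau> n)" "\<sigma> T" "u n T"] lip1D[OF lip(1), of n "\<tau> n" T]
        by (simp add: dist_real_def)
      then show "\<forall>\<^sub>F n in sequentially. dist (u n (\<tau> n)) (\<sigma> T) \<le> dist (\<tau> n) T + dist (u n T) (\<sigma> T)" by simp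
      show "(\<lambda>n. dist (\<tau> n) T + dist (u n T) (\<sigma> T)) \<longlonglongrightarrow> 0"
        using tendsto_add[OF T[THEN tendsto_dist_iff[THEN iffD1]] conv[THEN tendsto_dist_iff[THEN iffD1], of T]] by simp
    qed auto
    then show ?thesis by (rule tendsto_dist_iff[THEN iffD2])
  qed
  note hend = lsc_ennreal_eventually[OF h this]
  have "h (\<sigma> T) + line_integral g \<sigma> T
      = (\<integral>\<^sup>+ t. g (\<sigma> t) * indicator {0..T} t + h (\<sigma> T) * indicator {-2..-1} t \<partial>lborel)"
    unfolding line_integral_def by (simp add: nn_integral_add one add.commute)
  also have "\<dots> \<le> (\<integral>\<^sup>+ t. liminf (\<lambda>n. f n t) \<partial>lborel)"
  proof (rule nn_integral_mono_AE)
    \<comment> \<open>The time \<open>t = T\<close> is excluded, since \<open>\<tau> n\<close> may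
      stay below \<open>T\<close> and the indicator of \<open>{0..\<tau> n}\<close> then vanishes
      there.\<close>
    show "AE t in lborel. g (\<sigma> t) * indicator {0..T} t + h (\<sigma> T) * indicator {-2..-1} t \<le> liminf (\<lambda>n. f n t)"
      using AE_lborel_singleton[of T]
    proof eventually_elim
      fix t assume "t \<noteq> T"
      consider "0 \<le> t" "t < T" | "t \<in> {-2..-1}" | "t \<notin> {0..T}" "t \<notin> {-2..-1}" using \<open>t \<noteq> T\<close> by (auto simp: less_le)
      then show "g (\<sigma> t) * indicator {0..T} t + h (\<sigma> T) * indicator {-2..-1} t \<le> liminf (\<lambda>n. f n t)"
      proof cases
        case 1
        have "g (\<sigma> t) \<le> liminf (\<lambda>n. f n t)"
          unfolding le_Liminf_iff
        proof (intro allI impI)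
          fix y assume "y < g (\<sigma> t)"
          then have "\<forall>\<^sub>F n in sequentially. y < g (u n t)" by (rule lsc_ennreal_eventually[OF g conv])
          moreover have "\<forall>\<^sub>F n in sequentially. t < \<tau> n" using order_tendstoD(1)[OF T] 1 by simp
          ultimately show "\<forall>\<^sub>F n in sequentially. y < f n t"
            by eventually_elim (use 1 in \<open>auto simp: f_def\<close>)
        qed
        then show ?thesis using 1 by simp
      next
        case 2
        have "h (\<sigma> T) \<le> liminf (\<lambda>n. f n t)"
          unfolding le_Liminf_iff using hend 2 by (auto simp: f_def)
        then show ?thesis using 2 by simp
      qed simp
    qed
  qed
  also have "\<dots> \<le> liminf (\<lambda>n. \<integral>\<^sup>+ t. f n t \<partial>lborel)" by (rule nn_integral_liminf) simp
  also have "\<dots> \<le> liminf (\<lambda>n. c)"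
  proof (rule Liminf_mono, rule always_eventually, rule allI)
    fix n
    have "(\<integral>\<^sup>+ t. f n t \<partial>lborel) = line_integral g (u n) (\<tau> n) + h (u n (\<tau> n))"
      unfolding f_def line_integral_def by (simp add: nn_integral_add one)
    then show "(\<integral>\<^sup>+ t. f n t \<partial>lborel) \<le> c" using le[of n] by (simp add: add.commute)
  qed
  finally show ?thesis by (simp add: Liminf_const)
qed

text \<open>Sublevel sets are sequentially closed. Almost optimal curves for the approximating
  points are cut at the first entry into the set where \<open>h\<close> is at most \<epsilon>. Until
  then \<open>g\<close> exceeds \<delta>\<epsilon>, which bounds their length, and \<open>h\<close>
  is positive, which keeps them in \<open>S\<close>. Compactness gives a limit curve, whose cost is
  controlled by \<open>curve_cost_le_of_tendsto\<close>.\<close>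

lemma lsc_ennreal_curve_inf:
  fixes h g :: "'a::metric_space \<Rightarrow> ennreal"
  assumes h: "lsc_ennreal h" and g: "lsc_ennreal g" and \<delta>: "0 < \<delta>" and gh: "\<And>x. ennreal \<delta> * h x \<le> g x"
    and S: "closed S" "\<And>x. x \<notin> S \<Longrightarrow> h x = 0" and cpt: "\<And>x R. compact (cball x R \<inter> S)"
  shows "lsc_ennreal (curve_inf h g)"
proof -
  have le: "curve_inf h g x \<le> t" if conv: "xs \<longlonglongrightarrow> x" and xs: "\<And>n. curve_inf h g (xs n) \<le> t" and "t < top" for xs x t
  proof (rule ennreal_le_epsilon)
    fix e :: real assume e: "0 < e"
    \<comment> \<open>One half of \<open>e\<close> is spent on almost optimal curves, the other on
      the end value of \<open>h\<close> after cutting.\<close>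
    define \<epsilon> where "\<epsilon> = e / 2"
    have \<epsilon>: "0 < \<epsilon>" using e by (simp add: \<epsilon>_def)
    have ee: "ennreal \<epsilon> + ennreal \<epsilon> = ennreal e" using \<epsilon> by (simp flip: ennreal_plus add: \<epsilon>_def)
    obtain t0 where t0: "t = ennreal t0" "0 \<le> t0" using \<open>t < top\<close> by (cases t) auto
    define R where "R = (t0 + \<epsilon>) / (\<delta> * \<epsilon>)"
    show "curve_inf h g x \<le> t + ennreal e"
    \<comment> \<open>For a small value at \<open>x\<close> the constant curve suffices. Otherwise
      \<open>h\<close> exceeds \<epsilon> near \<open>x\<close>, so the starting points of the
      curves to be constructed lie in \<open>S\<close>.\<close>
    proof (cases "h x \<le> ennreal \<epsilon>")
      case True
      then have "curve_inf h g x \<le> ennreal \<epsilon>" using curve_inf_le order_trans by blast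
      also have "\<dots> \<le> t + ennreal e" using \<epsilon> by (intro add_increasing) (auto simp: \<epsilon>_def)
      finally show ?thesis .
    next
      case False
      have "\<forall>\<^sub>F n in sequentially. ennreal \<epsilon> < h (xs n) \<and> dist (xs n) x < 1"
        using lsc_ennreal_eventually[OF h conv] tendstoD[OF conv, of 1] False by (auto intro: eventually_conj)
      then obtain N where N: "\<And>n. n \<ge> N \<Longrightarrow> ennreal \<epsilon> < h (xs n) \<and> dist (xs n) x < 1"
        unfolding eventually_sequentially by blast
      define ys where "ys n = xs (n + N)" for n
      have ys: "ennreal \<epsilon> < h (ys n)" "dist (ys n) x < 1" "ys \<longlonglongrightarrow> x" for n
        using N[of "n + N"] LIMSEQ_ignore_initial_segment[OF conv, of N] unfolding ys_def by auto
      have "\<exists>\<gamma> T. lip1 \<gamma> \<and> 0 \<le> T \<and> T \<le> R \<and> \<gamma> 0 = ys n \<and> (\<forall>s. \<gamma> s \<in> cball x (R + 1) \<inter> S)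
          \<and> h (\<gamma> T) + line_integral g \<gamma> T \<le> t + ennreal e" for n
      proof -
        have "curve_inf h g (ys n) < t + ennreal \<epsilon>"
        proof (rule le_less_trans)
          show "curve_inf h g (ys n) \<le> t" using xs by (simp add: ys_def)
          show "t < t + ennreal \<epsilon>" using t0 \<epsilon> by (simp flip: ennreal_plus add: ennreal_lessI)
        qed
        then obtain \<gamma> T where \<gamma>: "lip1 \<gamma>" "0 \<le> T" "\<gamma> 0 = ys n" "h (\<gamma> T) + line_integral g \<gamma> T < t + ennreal \<epsilon>"
          by (rule curve_inf_lessD)
        obtain T' where T': "0 \<le> T'" "T' \<le> T" "\<And>s. 0 \<le> s \<Longrightarrow> s < T' \<Longrightarrow> ennreal \<epsilon> < h (\<gamma> s)"
          "T' = T \<or> h (\<gamma> T') \<le> ennreal \<epsilon>"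
          using first_hit[OF \<gamma>(1,2) h, of "ennreal \<epsilon>"] by metis
        have int: "line_integral g \<gamma> T' \<le> t + ennreal \<epsilon>"
        proof -
          have "line_integral g \<gamma> T' \<le> line_integral g \<gamma> T" using T'(2) by (rule line_integral_mono_time)
          also have "\<dots> \<le> h (\<gamma> T) + line_integral g \<gamma> T" by (simp add: add_increasing)
          finally show ?thesis using \<gamma>(4) by simp
        qed
        have cost: "h (\<gamma> T') + line_integral g \<gamma> T' \<le> t + ennreal e"
          using T'(4)
        proof
          assume "T' = T"
          then have "h (\<gamma> T') + line_integral g \<gamma> T' \<le> t + ennreal \<epsilon>" using \<gamma>(4) by simp
          also have "\<dots> \<le> t + ennreal e" using \<epsilon> by (intro add_left_mono ennreal_leI) (simp add: \<epsilon>_def)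
          finally show ?thesis .
        next
          assume "h (\<gamma> T') \<le> ennreal \<epsilon>"
          then have "h (\<gamma> T') + line_integral g \<gamma> T' \<le> ennreal \<epsilon> + (t + ennreal \<epsilon>)" using int by (rule add_mono)
          then show ?thesis by (simp add: ac_simps flip: ee)
        qed
        have "ennreal (\<delta> * \<epsilon> * T') = (\<integral>\<^sup>+ s. ennreal (\<delta> * \<epsilon>) * indicator {0..<T'} s \<partial>lborel)"
          using T'(1) \<delta> \<epsilon> by (simp add: nn_integral_cmult ennreal_mult)
        also have "\<dots> \<le> line_integral g \<gamma> T'"
          unfolding line_integral_def
        proof (intro nn_integral_mono)
          fix s
          have "ennreal (\<delta> * \<epsilon>) \<le> g (\<gamma> s)" if "s \<in> {0..<T'}"
          proof -
            have "ennreal (\<delta> * \<epsilon>) \<le> ennreal \<delta> * h (\<gamma> s)"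
              using T'(3)[of s] that \<delta> \<epsilon> by (auto simp: ennreal_mult intro!: mult_left_mono)
            then show ?thesis using gh order_trans by blast
          qed
          then show "ennreal (\<delta> * \<epsilon>) * indicator {0..<T'} s \<le> g (\<gamma> s) * indicator {0..T'} s"
            by (auto split: split_indicator)
        qed
        also note int
        finally have "\<delta> * \<epsilon> * T' \<le> t0 + \<epsilon>"
          using t0 \<epsilon> by (simp flip: ennreal_plus)
        then have "T' \<le> R" using \<delta> \<epsilon> by (simp add: R_def pos_le_divide_eq mult.commute)
        \<comment> \<open>Before \<open>T'\<close> the curve is in \<open>S\<close> because
          \<open>h\<close> is positive there, and closedness of \<open>S\<close> adds the end time.
          For \<open>T' = 0\<close> the half-open interval is empty, and the starting point is used
          instead.\<close>
        have inS: "\<gamma> s \<in> S" if s: "s \<in> {0..T'}" for s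
        proof (cases "T' = 0")
          case True
          then show ?thesis using s \<gamma>(3) ys(1)[of n] S(2) by force
        next
          case False
          have "closed (\<gamma> -` S)" using S(1) lipschitz_on_continuous_on[OF \<gamma>(1)] by (intro closed_vimage)
          moreover have "{0..<T'} \<subseteq> \<gamma> -` S" using T'(3) S(2) by force
          ultimately have "closure {0..<T'} \<subseteq> \<gamma> -` S" by (rule closure_minimal[rotated])
          then show ?thesis using False T'(1) s by auto
        qed
        \<comment> \<open>The curve is frozen outside \<open>{0..T'}\<close> so that all its values
          lie in one compact set.\<close>
        define \<rho> where "\<rho> s = \<gamma> (max 0 (min T' s))" for s
        have "lip1 \<rho>"
        proof (rule lip1I)
          fix a b :: real assume "a \<le> b"
          then show "dist (\<rho> a) (\<rho> b) \<le> b - a"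
            using lip1D[OF \<gamma>(1), of "max 0 (min T' a)" "max 0 (min T' b)"] unfolding \<rho>_def by linarith
        qed
        moreover have "\<rho> s \<in> cball x (R + 1) \<inter> S" for s
        proof -
          define s' where "s' = max 0 (min T' s)"
          have s': "s' \<in> {0..T'}" using T'(1) by (auto simp: s'_def)
          have "dist x (\<gamma> s') \<le> R + 1"
            using dist_triangle[of x "\<gamma> s'" "\<gamma> 0"] lip1D[OF \<gamma>(1), of 0 s'] ys(2)[of n] \<gamma>(3) s' \<open>T' \<le> R\<close>
            by (simp add: dist_commute)
          then show ?thesis using inS[OF s'] by (simp add: \<rho>_def s'_def)
        qed
        moreover have "\<rho> 0 = ys n" using \<gamma>(3) T'(1) by (simp add: \<rho>_def)
        moreover have "h (\<rho> T') + line_integral g \<rho> T' \<le> t + ennreal e"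
        proof -
          have "line_integral g \<rho> T' = line_integral g \<gamma> T'" by (intro line_integral_cong) (auto simp: \<rho>_def)
          then show ?thesis using cost T'(1) by (simp add: \<rho>_def)
        qed
        ultimately show ?thesis using T'(1) \<open>T' \<le> R\<close> by blast
      qed
      then obtain \<gamma> T where \<gamma>: "\<And>n. lip1 (\<gamma> n)" "\<And>n. 0 \<le> T n" "\<And>n. T n \<le> R" "\<And>n. \<gamma> n 0 = ys n"
        "\<And>n s. \<gamma> n s \<in> cball x (R + 1) \<inter> S" "\<And>n. h (\<gamma> n (T n)) + line_integral g (\<gamma> n) (T n) \<le> t + ennreal e"
        by metis
      obtain r \<sigma> where r: "strict_mono r" "lip1 \<sigma>" "\<And>s. (\<lambda>n. \<gamma> (r n) s) \<longlonglongrightarrow> \<sigma> s"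
        by (rule lip1_compact_subsequence[where \<gamma> = \<gamma>, OF \<gamma>(1) cpt \<gamma>(5)], rule that)
      \<comment> \<open>The cutting times are bounded as well; a further subsequence makes them
        converge.\<close>
      have "\<forall>n. T (r n) \<in> {0..R}" using \<gamma>(2,3) by auto
      then obtain T0 r' where r': "T0 \<in> {0..R}" "strict_mono r'" "((\<lambda>n. T (r n)) \<circ> r') \<longlonglongrightarrow> T0"
        by (rule seq_compactE[OF compact_imp_seq_compact[OF compact_Icc]])
      have "(\<lambda>n. \<gamma> (r n) 0) \<longlonglongrightarrow> x"
        using LIMSEQ_subseq_LIMSEQ[OF ys(3) r(1)] by (simp add: \<gamma>(4) o_def)
      then have "\<sigma> 0 = x" using r(3) LIMSEQ_unique by blast
      have "h (\<sigma> T0) + line_integral g \<sigma> T0 \<le> t + ennreal e"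
      proof (rule curve_cost_le_of_tendsto[OF h g, where u = "\<lambda>n. \<gamma> (r (r' n))" and \<tau> = "\<lambda>n. T (r (r' n))"])
        show "(\<lambda>n. \<gamma> (r (r' n)) s) \<longlonglongrightarrow> \<sigma> s" for s
          using LIMSEQ_subseq_LIMSEQ[OF r(3) r'(2), of s] by (simp add: o_def)
      qed (use \<gamma> r r' in \<open>auto simp: o_def\<close>)
      moreover have "curve_inf h g x \<le> h (\<sigma> T0) + line_integral g \<sigma> T0"
        using curve_inf_lower[OF r(2), of T0] r'(1) \<open>\<sigma> 0 = x\<close> by auto
      ultimately show ?thesis by simp
    qed
  qed
  have "closed {x. curve_inf h g x \<le> t}" for t
  proof (cases "t = top")
    case False
    then show ?thesis unfolding closed_sequential_limits using le[of _ _ t] by (auto simp: less_top)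
  qed simp
  then show ?thesis unfolding lsc_ennreal_def closed_def by (simp add: Compl_eq not_le)
qed

section \<open>Function lattices and outer capacity\<close>

lemma lsc_ennreal_of_lsc: "lsc (\<lambda>x. enn2ereal (f x)) \<Longrightarrow> lsc_ennreal f"
  unfolding lsc_def lsc_ennreal_def less_ennreal.rep_eq by blast

lemma tendsto_mult_ennreal_const:
  fixes f :: "'b \<Rightarrow> ennreal"
  shows "b < top \<Longrightarrow> (f \<longlongrightarrow> a) F \<Longrightarrow> ((\<lambda>x. f x * b) \<longlongrightarrow> a * b) F"
  using ennreal_tendsto_cmult[of b f a F] by (simp add: mult.commute)

lemma ennreal_add_INF_lessD:
  fixes a e :: ennreal
  assumes "a + (INF i\<in>I. F i) < e"
  shows "\<exists>i\<in>I. a + F i < e"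
proof (rule ccontr)
  assume "\<not> (\<exists>i\<in>I. a + F i < e)"
  then have "e - a \<le> F i" if "i \<in> I" for i
    using that assms by (auto simp: ennreal_minus_le_iff not_less top_unique)
  then have "e - a \<le> (INF i\<in>I. F i)" by (rule INF_greatest)
  then show False using assms by (auto simp: ennreal_minus_le_iff)
qed

lemma e2ennreal_abs_le_of_ediff:
  assumes "ediff a b \<le> i"
  shows "e2ennreal \<bar>a\<bar> \<le> i + e2ennreal \<bar>b\<bar>" "e2ennreal \<bar>b\<bar> \<le> i + e2ennreal \<bar>a\<bar>"
proof -
  have "e2ennreal \<bar>a\<bar> \<le> i + e2ennreal \<bar>b\<bar> \<and> e2ennreal \<bar>b\<bar> \<le> i + e2ennreal \<bar>a\<bar>"
  proof (cases "\<bar>a\<bar> \<noteq> \<infinity> \<and> \<bar>b\<bar> \<noteq> \<infinity>")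
    case True
    then obtain p q where pq: "a = ereal p" "b = ereal q" by (cases a; cases b) auto
    have i: "ennreal \<bar>p - q\<bar> \<le> i" using assms by (simp add: ediff_def pq)
    have "ennreal \<bar>p\<bar> \<le> ennreal \<bar>p - q\<bar> + ennreal \<bar>q\<bar>" "ennreal \<bar>q\<bar> \<le> ennreal \<bar>p - q\<bar> + ennreal \<bar>p\<bar>"
      by (auto simp flip: ennreal_plus intro!: ennreal_leI)
    then have "ennreal \<bar>p\<bar> \<le> i + ennreal \<bar>q\<bar>" "ennreal \<bar>q\<bar> \<le> i + ennreal \<bar>p\<bar>"
      using add_right_mono[OF i] order_trans by blast+
    then show ?thesis by (simp add: pq)
  next
    case False
    then have "i = \<infinity>" using assms by (auto simp: ediff_def top_unique split: if_splits)
    then show ?thesis by simp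
  qed
  then show "e2ennreal \<bar>a\<bar> \<le> i + e2ennreal \<bar>b\<bar>" "e2ennreal \<bar>b\<bar> \<le> i + e2ennreal \<bar>a\<bar>" by auto
qed

lemma upper_grad_of_upper_gradient:
  "upper_gradient g u \<Longrightarrow> upper_grad g (\<lambda>x. min 1 (e2ennreal \<bar>u x\<bar>))"
  unfolding upper_gradient_def upper_grad_def
  by (blast intro: min_1_le_add e2ennreal_abs_le_of_ediff)

text \<open>The bound 1 keeps the end values finite, so the infinite case of \<open>ediff\<close>
  does not arise.\<close>

lemma upper_gradient_of_upper_grad:
  assumes upper_grad: "upper_grad g w" and w: "\<And>x. w x \<le> 1"
  shows "upper_gradient g (\<lambda>x. enn2ereal (w x))"
  unfolding upper_gradient_def
proof (intro conjI allI impI)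
  show "g \<in> borel_measurable borel" using upper_grad by (simp add: upper_grad_def)
  fix \<gamma> :: "real \<Rightarrow> 'a" and l :: real assume "arc_length_curve \<gamma> l"
  then have le: "w (\<gamma> 0) \<le> w (\<gamma> l) + line_integral g \<gamma> l" "w (\<gamma> l) \<le> w (\<gamma> 0) + line_integral g \<gamma> l"
    using upper_grad by (auto simp: upper_grad_def)
  have fin: "w x < top" for x using w[of x] by (rule le_less_trans) simp
  obtain p q where pq: "w (\<gamma> 0) = ennreal p" "w (\<gamma> l) = ennreal q" "0 \<le> p" "0 \<le> q"
    using fin[of "\<gamma> 0"] fin[of "\<gamma> l"] by (cases "w (\<gamma> 0)"; cases "w (\<gamma> l)") auto
  show "ediff (enn2ereal (w (\<gamma> 0))) (enn2ereal (w (\<gamma> l))) \<le> line_integral g \<gamma> l"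
  proof (cases "line_integral g \<gamma> l")
    case (real r)
    then show ?thesis using le pq by (auto simp: ediff_def simp flip: ennreal_plus intro!: ennreal_leI)
  qed simp
qed

locale function_lattice =
  fixes M :: "'a::metric_space measure" and nX :: "('a \<Rightarrow> ereal) \<Rightarrow> ennreal" and c :: real
  assumes mm: "mm_space M" and vc: "vitali_caratheodory M nX" and c: "1 \<le> c"
    and null: "\<And>u. u \<in> borel_measurable M \<Longrightarrow> nX u = 0 \<longleftrightarrow> (AE x in M. u x = 0)"
    and scale: "\<And>u a. u \<in> borel_measurable M \<Longrightarrow> nX (\<lambda>x. ereal a * u x) = ennreal \<bar>a\<bar> * nX u"
    and quasi_add: "\<And>u v. u \<in> borel_measurable M \<Longrightarrow> v \<in> borel_measurable M \<Longrightarrow>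
          nX (\<lambda>x. u x + v x) \<le> ennreal c * (nX u + nX v)"
    and mono: "\<And>u v. u \<in> borel_measurable M \<Longrightarrow> v \<in> borel_measurable M \<Longrightarrow>
          (AE x in M. \<bar>u x\<bar> \<le> \<bar>v x\<bar>) \<Longrightarrow> nX u \<le> nX v"
    and quasi_suminf: "\<And>us :: nat \<Rightarrow> 'a \<Rightarrow> ereal. (\<And>n. us n \<in> borel_measurable M) \<Longrightarrow> (\<And>n x. 0 \<le> us n x) \<Longrightarrow>
          nX (\<lambda>x. \<Sum>n. us n x) \<le> (\<Sum>n. ennreal (c ^ Suc n) * nX (us n))"
    and cont: "\<And>us u. (\<And>n. in_X M nX (us n)) \<Longrightarrow> in_X M nX u \<Longrightarrow>
          (\<lambda>n. nX (\<lambda>x. us n x - u x)) \<longlonglongrightarrow> 0 \<Longrightarrow> (\<lambda>n. nX (us n)) \<longlonglongrightarrow> nX u"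
begin

lemma borel_imp_measurable: "f \<in> borel_measurable borel \<Longrightarrow> f \<in> borel_measurable M"
proof -
  have "borel_measurable borel \<subseteq> borel_measurable M"
    by (rule measurable_mono) (use mm in \<open>auto simp: mm_space_def\<close>)
  then show "f \<in> borel_measurable borel \<Longrightarrow> f \<in> borel_measurable M" by blast
qed

section \<open>The quasinorm on nonnegative functions\<close>

definition N :: "('a \<Rightarrow> ennreal) \<Rightarrow> ennreal" where
  "N f = nX (\<lambda>x. enn2ereal (f x))"

lemma N_mono:
  assumes [measurable]: "f \<in> borel_measurable M" "g \<in> borel_measurable M" and "\<And>x. f x \<le> g x"
  shows "N f \<le> N g"
  unfolding N_def using assms(3) by (intro mono) (auto simp: less_eq_ennreal.rep_eq)

lemma N_cmult:
  assumes [measurable]: "f \<in> borel_measurable M" and "0 \<le> a"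
  shows "N (\<lambda>x. ennreal a * f x) = ennreal a * N f"
  using scale[of "\<lambda>x. enn2ereal (f x)" a] assms(2) by (simp add: N_def times_ennreal.rep_eq)

lemma N_add:
  assumes [measurable]: "f \<in> borel_measurable M" "g \<in> borel_measurable M"
  shows "N (\<lambda>x. f x + g x) \<le> ennreal c * (N f + N g)"
  using quasi_add[of "\<lambda>x. enn2ereal (f x)" "\<lambda>x. enn2ereal (g x)"] by (simp add: N_def plus_ennreal.rep_eq)

lemma N_suminf:
  assumes [measurable]: "\<And>n. f n \<in> borel_measurable M"
  shows "N (\<lambda>x. \<Sum>n. f n x) \<le> (\<Sum>n. ennreal (c ^ Suc n) * N (f n))"
  using quasi_suminf[of "\<lambda>n x. enn2ereal (f n x)"] by (simp add: N_def)

text \<open>The function \<open>w\<close> that is infinite where \<open>f\<close> is and zero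
  elsewhere satisfies \<open>2 * w = w\<close>. Its norm is finite and equal to its double, hence
  zero.\<close>

lemma AE_finite:
  assumes [measurable]: "f \<in> borel_measurable M" and fin: "N f < top"
  shows "AE x in M. f x \<noteq> top"
proof -
  define w where "w x = (if f x = top then top else (0::ennreal))" for x
  have [measurable]: "w \<in> borel_measurable M" unfolding w_def by measurable
  have "N w \<le> N f" by (intro N_mono) (auto simp: w_def)
  have "N w = N (\<lambda>x. ennreal 2 * w x)" by (intro arg_cong[of _ _ N]) (auto simp: w_def fun_eq_iff ennreal_mult_top)
  also have "\<dots> = ennreal 2 * N w" by (intro N_cmult) auto
  finally have eq: "N w = 2 * N w" by simp
  have "N w < top" using \<open>N w \<le> N f\<close> fin by (rule le_less_trans)
  then obtain r where "N w = ennreal r" "0 \<le> r" by (cases "N w") auto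
  then have "N w = 0" using eq by (auto simp flip: ennreal_numeral ennreal_mult)
  then have "AE x in M. enn2ereal (w x) = 0" unfolding N_def by (subst (asm) null) auto
  then show ?thesis by eventually_elim (auto simp: w_def split: if_splits)
qed

text \<open>Where \<open>f\<close> is finite, hence almost everywhere, the perturbation differs from
  \<open>f\<close> by \<open>h / (n + 1)\<close>, whose norm tends to 0; continuity of the quasinorm
  applies.\<close>

lemma N_perturb_tendsto:
  assumes [measurable]: "f \<in> borel_measurable M" "h \<in> borel_measurable M" and fin: "N f < top" "N h < top"
  shows "(\<lambda>n. N (\<lambda>x. f x + ennreal (1 / real (Suc n)) * h x)) \<longlonglongrightarrow> N f"
  unfolding N_def
proof (rule cont)
  have Nh: "N (\<lambda>x. ennreal (1 / real (Suc n)) * h x) = ennreal (1 / real (Suc n)) * N h" for n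
    by (intro N_cmult) auto
  show "in_X M nX (\<lambda>x. enn2ereal (f x))" using fin by (auto simp: in_X_def N_def)
  show "in_X M nX (\<lambda>x. enn2ereal (f x + ennreal (1 / real (Suc n)) * h x))" for n
  proof -
    have "N (\<lambda>x. f x + ennreal (1 / real (Suc n)) * h x) \<le> ennreal c * (N f + ennreal (1 / real (Suc n)) * N h)"
      unfolding Nh[symmetric] by (intro N_add) auto
    also have "\<dots> < top" using fin by (simp add: ennreal_mult_less_top)
    finally show ?thesis by (auto simp: in_X_def N_def)
  qed
  have le: "nX (\<lambda>x. enn2ereal (f x + ennreal (1 / real (Suc n)) * h x) - enn2ereal (f x))
      \<le> ennreal (1 / real (Suc n)) * N h" for n
    unfolding Nh[symmetric] unfolding N_def
  proof (rule mono)
    show "AE x in M. \<bar>enn2ereal (f x + ennreal (1 / real (Suc n)) * h x) - enn2ereal (f x)\<bar>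
        \<le> \<bar>enn2ereal (ennreal (1 / real (Suc n)) * h x)\<bar>"
      using AE_finite[OF assms(1) fin(1)]
    proof eventually_elim
      fix x assume "f x \<noteq> top"
      then show "\<bar>enn2ereal (f x + ennreal (1 / real (Suc n)) * h x) - enn2ereal (f x)\<bar>
        \<le> \<bar>enn2ereal (ennreal (1 / real (Suc n)) * h x)\<bar>"
        by (cases "enn2ereal (f x)"; cases "enn2ereal (ennreal (1 / real (Suc n)) * h x)")
          (use enn2ereal_nonneg in \<open>auto simp: plus_ennreal.rep_eq\<close>)
    qed
  qed auto
  have "(\<lambda>n. ennreal (1 / real (Suc n)) * N h) \<longlonglongrightarrow> ennreal 0 * N h"
    using fin LIMSEQ_Suc[OF lim_const_over_n[of 1]]
    by (intro tendsto_mult_ennreal_const tendsto_ennrealI) auto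
  then have lim: "(\<lambda>n. ennreal (1 / real (Suc n)) * N h) \<longlonglongrightarrow> 0" by simp
  show "(\<lambda>n. nX (\<lambda>x. enn2ereal (f x + ennreal (1 / real (Suc n)) * h x) - enn2ereal (f x))) \<longlonglongrightarrow> 0"
    by (rule tendsto_sandwich[OF _ _ tendsto_const lim]) (rule always_eventually, rule allI, rule zero_le le)+
qed

lemma lsc_majorant:
  assumes [measurable]: "f \<in> borel_measurable M" and "N f < e"
  obtains h where "lsc_ennreal h" "\<And>x. f x \<le> h x" "N h < e"
proof -
  have "nX (\<lambda>x. enn2ereal (f x)) = (INF v \<in> {v. lsc v \<and> (\<forall>x. \<bar>enn2ereal (f x)\<bar> \<le> v x)}. nX v)"
    using vc by (auto simp: vitali_caratheodory_def)
  then obtain v where v: "lsc v" "\<And>x. enn2ereal (f x) \<le> v x" "nX v < e"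
    using assms(2) unfolding N_def by (auto simp: INF_less_iff)
  have v0: "0 \<le> v x" for x using v(2)[of x] by (meson enn2ereal_nonneg order_trans)
  define h where "h x = e2ennreal (v x)" for x
  have eq: "enn2ereal (h x) = v x" for x using v0 by (simp add: h_def enn2ereal_e2ennreal)
  show ?thesis
  proof (rule that)
    show "lsc_ennreal h" using v(1) by (intro lsc_ennreal_of_lsc) (simp add: eq)
    show "f x \<le> h x" for x using v(2)[of x] by (simp add: less_eq_ennreal.rep_eq eq)
    show "N h < e" using v(3) by (simp add: N_def eq)
  qed
qed

text \<open>Truncating the absolute value of an admissible function at 1 keeps its upper gradients
  and does not increase its norm. With \<open>capacity_leI\<close> this reduces capacity to
  functions with values in [0, 1].\<close>

lemma capacity_lessD:
  assumes "capacity M nX E < e"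
  obtains w g where "w \<in> borel_measurable M" "\<And>x. w x \<le> 1" "\<And>x. x \<in> E \<Longrightarrow> w x = 1" "upper_grad g w" "N w + N g < e"
proof -
  obtain u where u: "in_N1X M nX u" "\<And>x. x \<in> E \<Longrightarrow> 1 \<le> u x" "N1_norm nX u < e"
    using assms unfolding capacity_def INF_less_iff by auto
  obtain g where g: "upper_gradient g u" "nX u + N g < e"
    using ennreal_add_INF_lessD u(3) unfolding N1_norm_def N_def by blast
  have [measurable]: "u \<in> borel_measurable M" using u(1) by (simp add: in_N1X_def in_X_def)
  define w where "w x = min 1 (e2ennreal \<bar>u x\<bar>)" for x
  have [measurable]: "w \<in> borel_measurable M" unfolding w_def by measurable
  have wle: "w x \<le> e2ennreal \<bar>u x\<bar>" for x by (simp add: w_def)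
  have "N w \<le> nX u"
    unfolding N_def
  proof (rule mono)
    have "enn2ereal (w x) \<le> \<bar>u x\<bar>" for x
      using wle[of x] by (simp add: less_eq_ennreal.rep_eq enn2ereal_e2ennreal)
    then show "AE x in M. \<bar>enn2ereal (w x)\<bar> \<le> \<bar>u x\<bar>" by simp
  qed auto
  show ?thesis
  proof (rule that)
    show "w x = 1" if "x \<in> E" for x
    proof -
      have "1 \<le> \<bar>u x\<bar>" using u(2)[OF that] abs_ge_self order_trans by (metis abs_ereal_ge0 zero_less_one_ereal less_imp_le)
      then have "e2ennreal 1 \<le> e2ennreal \<bar>u x\<bar>" by (rule e2ennreal_mono)
      then show ?thesis by (simp add: w_def one_ennreal.abs_eq)
    qed
    show "upper_grad g w" unfolding w_def using g(1) by (rule upper_grad_of_upper_gradient)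
    show "N w + N g < e" using g(2) \<open>N w \<le> nX u\<close> by (meson add_right_mono le_less_trans)
  qed (auto simp: w_def)
qed

lemma capacity_leI:
  assumes [measurable]: "w \<in> borel_measurable M" and w: "\<And>x. w x \<le> 1" "\<And>x. x \<in> E \<Longrightarrow> w x = 1" and g: "upper_grad g w"
  shows "capacity M nX E \<le> N w + N g"
proof (cases "N w + N g < top")
  case True
  have "N1_norm nX (\<lambda>x. enn2ereal (w x)) \<le> N w + N g"
    unfolding N1_norm_def N_def using upper_gradient_of_upper_grad[OF g w(1)]
    by (intro add_left_mono INF_lower) auto
  moreover have "in_N1X M nX (\<lambda>x. enn2ereal (w x))"
    using True calculation by (auto simp: in_N1X_def in_X_def N_def intro: le_less_trans)
  moreover have "1 \<le> enn2ereal (w x)" if "x \<in> E" for x using w(2)[OF that] by (simp add: one_ennreal.rep_eq)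
  ultimately show ?thesis unfolding capacity_def by (intro INF_lower2[of "\<lambda>x. enn2ereal (w x)"]) auto
qed (auto simp: not_less top_unique)

lemma capacity_mono: "A \<subseteq> B \<Longrightarrow> capacity M nX A \<le> capacity M nX B"
  unfolding capacity_def by (intro INF_superset_mono) auto

text \<open>The truncation of \<open>curve_inf h g\<close> at 1 is admissible for its superlevel
  set, lies below \<open>h\<close> and has \<open>g\<close> as an upper gradient.\<close>

lemma capacity_curve_inf_le:
  assumes h: "lsc_ennreal h" and g: "lsc_ennreal g" and "0 < \<delta>" "\<And>x. ennreal \<delta> * h x \<le> g x"
    and "closed S" "\<And>x. x \<notin> S \<Longrightarrow> h x = 0" "\<And>x R. compact (cball x R \<inter> S)"
  shows "open {x. 1 < curve_inf h g x}" "capacity M nX {x. 1 < curve_inf h g x} \<le> N h + N g"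
proof -
  have lsc_inf: "lsc_ennreal (curve_inf h g)" using assms by (rule lsc_ennreal_curve_inf)
  then show "open {x. 1 < curve_inf h g x}" by (simp add: lsc_ennreal_def)
  have [measurable]: "curve_inf h g \<in> borel_measurable M" "h \<in> borel_measurable M" and "g \<in> borel_measurable borel"
      and [measurable]: "g \<in> borel_measurable M"
    using lsc_inf h g by (auto intro: borel_imp_measurable lsc_ennreal_measurable)
  have "capacity M nX {x. 1 < curve_inf h g x} \<le> N (\<lambda>x. min 1 (curve_inf h g x)) + N g"
    by (intro capacity_leI upper_grad_min_1_curve_inf \<open>g \<in> borel_measurable borel\<close>) auto
  also have "\<dots> \<le> N h + N g"
    by (intro add_right_mono N_mono) (auto intro: min.coboundedI2 curve_inf_le)
  finally show "capacity M nX {x. 1 < curve_inf h g x} \<le> N h + N g" .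
qed

theorem outer_capacity_of_proper:
  assumes proper: "\<And>(x::'a) r. compact (cball x r)"
  shows "outer_capacity M nX"
  unfolding outer_capacity_def
proof (intro allI antisym INF_greatest)
  fix E :: "'a set" and G assume "G \<in> {G. open G \<and> E \<subseteq> G}"
  then show "capacity M nX E \<le> capacity M nX G" by (intro capacity_mono) auto
next
  fix E :: "'a set"
  show "(INF G \<in> {G. open G \<and> E \<subseteq> G}. capacity M nX G) \<le> capacity M nX E"
  proof (rule dense_ge)
    fix e assume "capacity M nX E < e"
    then obtain w g where [measurable]: "w \<in> borel_measurable M" and w: "\<And>x. x \<in> E \<Longrightarrow> w x = 1"
      and upper_grad: "upper_grad g w" and Nwg: "N w + N g < e"
      by (rule capacity_lessD) blast
    have [measurable]: "g \<in> borel_measurable M" using upper_grad by (simp add: upper_grad_def borel_imp_measurable)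
    \<comment> \<open>A factor above 1 places \<open>E\<close> inside the strict superlevel set,
      which is the one that lower semicontinuity makes open.\<close>
    have "\<exists>a>1. ennreal a * (N w + N g) < e"
    proof -
      have fin: "N w + N g \<noteq> top" using Nwg by auto
      have "((\<lambda>a. ennreal a * (N w + N g)) \<longlongrightarrow> ennreal 1 * (N w + N g)) (at_right 1)"
        using fin by (intro tendsto_mult_ennreal_const tendsto_ennrealI tendsto_ident_at) (auto simp: less_top)
      then have "\<forall>\<^sub>F a in at_right 1. ennreal a * (N w + N g) < e"
        using Nwg by (intro order_tendstoD(2)) auto
      then have "\<forall>\<^sub>F a in at_right 1. 1 < a \<and> ennreal a * (N w + N g) < e"
        using eventually_at_right_less by (rule eventually_conj[rotated])
      then show ?thesis using eventually_happens'[of "at_right (1::real)"] by (auto simp: trivial_limit_at_right_real)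
    qed
    then obtain a where a: "1 < a" "ennreal a * (N w + N g) < e" by blast
    define wa ga where "wa x = ennreal a * w x" and "ga x = ennreal a * g x" for x
    have [measurable]: "wa \<in> borel_measurable M" "ga \<in> borel_measurable M" unfolding wa_def ga_def by measurable
    have "N wa + N ga < e" using a unfolding wa_def ga_def by (simp add: N_cmult distrib_left)
    then have fin: "N ga < top" by (auto simp: less_top[symmetric])
    \<comment> \<open>Each majorant is chosen within the slack that the other summand leaves below
      \<open>e\<close>.\<close>
    then have "N wa < e - N ga" using \<open>N wa + N ga < e\<close> by (simp add: less_diff_eq_ennreal)
    then obtain h where h: "lsc_ennreal h" "\<And>x. wa x \<le> h x" "N h < e - N ga"
      using lsc_majorant[of wa] by auto
    have [measurable]: "h \<in> borel_measurable M" using h(1) by (intro borel_imp_measurable lsc_ennreal_measurable)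
    have "N h + N ga < e" using h(3) fin by (simp add: less_diff_eq_ennreal)
    have "N h < top" "N ga < top" using \<open>N h + N ga < e\<close> by (auto simp: less_top[symmetric])
    \<comment> \<open>The quasi-triangle inequality would cost a factor \<open>c\<close> here;
      continuity of the quasinorm adds a small multiple of \<open>h\<close> without that
      loss.\<close>
    have "(\<lambda>n. N h + N (\<lambda>x. ga x + ennreal (1 / real (Suc n)) * h x)) \<longlonglongrightarrow> N h + N ga"
      by (intro tendsto_intros N_perturb_tendsto \<open>N h < top\<close> \<open>N ga < top\<close>) auto
    then have "\<forall>\<^sub>F n in sequentially. N h + N (\<lambda>x. ga x + ennreal (1 / real (Suc n)) * h x) < e"
      using \<open>N h + N ga < e\<close> by (rule order_tendstoD(2))
    then obtain n where n: "N h + N (\<lambda>x. ga x + ennreal (1 / real (Suc n)) * h x) < e"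
      using eventually_happens'[OF sequentially_bot] by blast
    define \<delta> where "\<delta> = 1 / real (Suc n)"
    have "N (\<lambda>x. ga x + ennreal \<delta> * h x) < e - N h"
      using n \<open>N h < top\<close> unfolding \<delta>_def by (simp add: less_diff_eq_ennreal add.commute)
    then obtain k where k: "lsc_ennreal k" "\<And>x. ga x + ennreal \<delta> * h x \<le> k x" "N k < e - N h"
      using lsc_majorant[of "\<lambda>x. ga x + ennreal \<delta> * h x"] by auto
    have kh: "ennreal \<delta> * h x \<le> k x" and kg: "ga x \<le> k x" for x
      using k(2)[of x] by (meson add_increasing add_increasing2 order_trans order_refl zero_le)+
    have "0 < \<delta>" by (simp add: \<delta>_def)
    note cap_le = capacity_curve_inf_le[OF h(1) k(1) this kh closed_UNIV, simplified, OF proper]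
    have "E \<subseteq> {x. 1 < curve_inf h k x}"
    proof
      fix x assume "x \<in> E"
      have "ennreal a * w x \<le> curve_inf h k x"
        using h(2) kg by (intro curve_inf_ge_of_upper_grad[OF upper_grad]) (auto simp: wa_def ga_def)
      then show "x \<in> {x. 1 < curve_inf h k x}"
        using a w[OF \<open>x \<in> E\<close>] by (auto intro: less_le_trans[rotated])
    qed
    then have "(INF G \<in> {G. open G \<and> E \<subseteq> G}. capacity M nX G) \<le> capacity M nX {x. 1 < curve_inf h k x}"
      using cap_le(1) by (intro INF_lower) auto
    also have "\<dots> \<le> N h + N k" by (rule cap_le(2))
    also have "\<dots> \<le> e" using k(3) \<open>N h < top\<close> by (simp add: less_diff_eq_ennreal add.commute less_imp_le)
    finally show "(INF G \<in> {G. open G \<and> E \<subseteq> G}. capacity M nX G) \<le> e" .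
  qed
qed

end

section \<open>Quasicontinuity in locally compact spaces\<close>

text \<open>Zorn's lemma gives a maximal set of points with mutual distances at least
  \<open>e\<close>, which is a net by maximality. The balls of radius \<open>e / 2\<close> about its
  points in a bounded region are disjoint, have positive measure and lie in a ball of finite
  measure, so there are only countably many.\<close>

lemma countable_net:
  fixes M :: "'a::metric_space measure"
  assumes mm: "mm_space M" and e: "0 < e"
  obtains D :: "'a set" where "countable D" "\<And>x. \<exists>d\<in>D. dist x d < e"
proof -
  define \<A> where "\<A> = {D::'a set. \<forall>x\<in>D. \<forall>y\<in>D. x \<noteq> y \<longrightarrow> e \<le> dist x y}"
  have "\<exists>D\<in>\<A>. \<forall>X\<in>\<A>. D \<subseteq> X \<longrightarrow> X = D"
  proof (rule Zorn_Lemma, rule ballI)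
    fix C assume C: "C \<in> chains \<A>"
    show "\<Union>C \<in> \<A>"
      unfolding \<A>_def
    proof (clarsimp)
      fix x y X Y assume *: "x \<in> X" "X \<in> C" "y \<in> Y" "Y \<in> C" "x \<noteq> y"
      then have "X \<subseteq> Y \<or> Y \<subseteq> X" "X \<in> \<A>" "Y \<in> \<A>" using C by (auto simp: chains_def chain_subset_def)
      then show "e \<le> dist x y" using * unfolding \<A>_def by blast
    qed
  qed
  then obtain D where D: "D \<in> \<A>" "\<And>X. X \<in> \<A> \<Longrightarrow> D \<subseteq> X \<Longrightarrow> X = D" by blast
  have net: "\<exists>d\<in>D. dist x d < e" for x
  proof (rule ccontr)
    assume "\<not> (\<exists>d\<in>D. dist x d < e)"
    then have far: "\<And>d. d \<in> D \<Longrightarrow> e \<le> dist x d" by auto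
    then have "insert x D \<in> \<A>" using D(1) by (auto simp: \<A>_def dist_commute)
    then have "x \<in> D" using D(2) by blast
    then show False using far[of x] e by simp
  qed
  have ball: "ball x r \<in> sets M" "0 < r \<Longrightarrow> 0 < emeasure M (ball x r)" "emeasure M (ball x r) < top" for x r
    using mm by (auto simp: mm_space_def) (cases "0 < r"; auto simp: ball_empty)
  then have fm: "ball x r \<in> fmeasurable M" for x r by (auto intro: fmeasurableI)
  define f where "f d = measure M (ball d (e / 2))" for d
  have fpos: "f d > 0" for d
    using ball[where x = d and r = "e / 2"] e by (simp add: f_def measure_def enn2real_positive_iff)
  fix z :: 'a
  have "countable (D \<inter> ball z (real n))" for n
  proof -
    have "sum f F \<le> measure M (ball z (real n + e))" if F: "finite F" "F \<subseteq> D \<inter> ball z (real n)" for F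
    proof -
      have "disjoint_family_on (\<lambda>d. ball d (e / 2)) F"
        unfolding disjoint_family_on_def
      proof (intro ballI impI)
        fix a b assume "a \<in> F" "b \<in> F" "a \<noteq> b"
        then have ab: "e \<le> dist a b" using F D(1) by (auto simp: \<A>_def)
        show "ball a (e / 2) \<inter> ball b (e / 2) = {}"
        proof (rule ccontr)
          assume "ball a (e / 2) \<inter> ball b (e / 2) \<noteq> {}"
          then obtain y where "dist a y < e / 2" "dist b y < e / 2" by auto
          then show False using ab dist_triangle2[of a b y] by simp
        qed
      qed
      then have "sum f F = measure M (\<Union>d\<in>F. ball d (e / 2))"
        unfolding f_def using F(1) ball by (subst measure_finite_Union) (auto simp: less_top)
      also have "\<dots> \<le> measure M (ball z (real n + e))"
      proof (intro measure_mono_fmeasurable fm)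
        show "(\<Union>d\<in>F. ball d (e / 2)) \<subseteq> ball z (real n + e)"
        proof clarify
          fix d y assume "d \<in> F" "y \<in> ball d (e / 2)"
          then show "y \<in> ball z (real n + e)" using F(2) e dist_triangle[of z y d] by force
        qed
        show "(\<Union>d\<in>F. ball d (e / 2)) \<in> sets M" using ball F(1) by auto
      qed
      finally show ?thesis .
    qed
    then have "f summable_on (D \<inter> ball z (real n))"
      using fpos by (intro nonneg_bdd_above_summable_on) (auto simp: bdd_above_def less_imp_le)
    then have "countable {d \<in> D \<inter> ball z (real n). f d \<noteq> 0}" by (rule summable_countable_real)
    moreover have "{d \<in> D \<inter> ball z (real n). f d \<noteq> 0} = D \<inter> ball z (real n)" using fpos by (auto simp: less_imp_neq[THEN not_sym])
    ultimately show ?thesis by simp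
  qed
  then have "countable (\<Union>n. D \<inter> ball z (real n))" by (intro countable_UN) auto
  moreover have "D = (\<Union>n. D \<inter> ball z (real n))" using reals_Archimedean2 by auto
  ultimately have "countable D" by simp
  then show ?thesis using net by (rule that)
qed

text \<open>Take the balls of radius \<open>1 / (k + 1)\<close> about the points of a countable net
  of the same fineness, for all \<open>k\<close>, and keep those whose doubled closed ball is
  compact.\<close>

lemma countable_cover_compact_balls:
  fixes M :: "'a::metric_space measure"
  assumes mm: "mm_space M" and lc: "locally_compact_space (euclidean :: 'a topology)"
  shows "\<exists>(d :: nat \<Rightarrow> 'a) \<rho>. (\<forall>n. 0 < \<rho> n \<and> compact (cball (d n) (2 * \<rho> n))) \<and> (\<forall>x. \<exists>n. x \<in> ball (d n) (\<rho> n))"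
proof -
  have "\<exists>D :: 'a set. countable D \<and> (\<forall>x. \<exists>d\<in>D. dist x d < 1 / real (Suc k))" for k
  proof -
    obtain D :: "'a set" where "countable D" "\<And>x. \<exists>d\<in>D. dist x d < 1 / real (Suc k)"
      by (rule countable_net[OF mm, of "1 / real (Suc k)"], simp, rule that)
    then show ?thesis by blast
  qed
  then obtain D :: "nat \<Rightarrow> 'a set" where D: "\<And>k. countable (D k)" "\<And>k x. \<exists>d\<in>D k. dist x d < 1 / real (Suc k)"
    by metis
  define P where "P = {(k, d). d \<in> D k \<and> compact (cball d (2 * (1 / real (Suc k))))}"
  have "countable P"
    by (rule countable_subset[of _ "SIGMA k:UNIV. D k"]) (use D in \<open>auto simp: P_def\<close>)
  have cover: "\<exists>(k, d)\<in>P. x \<in> ball d (1 / real (Suc k))" for x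
  proof -
    obtain U K where UK: "open U" "compact K" "x \<in> U" "U \<subseteq> K"
    proof -
      have "\<exists>U K. openin euclidean U \<and> compactin euclidean K \<and> x \<in> U \<and> U \<subseteq> K"
        using lc by (simp add: locally_compact_space_def)
      then show ?thesis using that by auto
    qed
    obtain r where r: "0 < r" "cball x r \<subseteq> U" using UK by (meson open_contains_cball)
    \<comment> \<open>The distance from \<open>x\<close> to the centre is below \<open>r / 3\<close>
      and the doubled radius below \<open>2 * r / 3\<close>, so the doubled ball stays in
      \<open>cball x r\<close>.\<close>
    obtain k where k: "1 / real (Suc k) < r / 3" using nat_approx_posE[of "r / 3"] r by auto
    obtain d where d: "d \<in> D k" "dist x d < 1 / real (Suc k)" using D(2) by blast
    have "cball d (2 * (1 / real (Suc k))) \<subseteq> K"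
    proof
      fix y assume "y \<in> cball d (2 * (1 / real (Suc k)))"
      then have "y \<in> cball x r" using dist_triangle[of x y d] d k by auto
      then show "y \<in> K" using r UK by auto
    qed
    then have "compact (cball d (2 * (1 / real (Suc k))))"
      using UK(2) by (metis closed_cball compact_Int_closed inf.absorb_iff2)
    then show ?thesis using d by (force simp: P_def dist_commute)
  qed
  then have "P \<noteq> {}" by blast
  define q where "q = from_nat_into P"
  have q: "range q = P" using \<open>countable P\<close> \<open>P \<noteq> {}\<close> by (simp add: q_def)
  then have qP: "q n \<in> P" for n by auto
  show ?thesis
  proof (intro exI[of _ "\<lambda>n. snd (q n)"] exI[of _ "\<lambda>n. 1 / real (Suc (fst (q n)))"] conjI allI)
    show "compact (cball (snd (q n)) (2 * (1 / real (Suc (fst (q n))))))" for n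
      using qP[of n] by (auto simp: P_def)
    fix x
    show "\<exists>n. x \<in> ball (snd (q n)) (1 / real (Suc (fst (q n))))"
    proof -
      obtain k d where "(k, d) \<in> P" "x \<in> ball d (1 / real (Suc k))" using cover by blast
      moreover then obtain n where "q n = (k, d)" using q by (metis imageE)
      ultimately show ?thesis by (intro exI[of _ n]) simp
    qed
  qed simp
qed

section \<open>Countable unions and local open enclosures\<close>

context function_lattice
begin

text \<open>The supremum of functions admissible for the single sets is admissible for the union,
  and the sum of their upper gradients is an upper gradient of it. The weights come from the
  quasinorm inequality for series.\<close>

lemma capacity_UN_le:
  assumes "\<And>n::nat. capacity M nX (G n) < \<eta> n"
  shows "capacity M nX (\<Union>n. G n) \<le> (\<Sum>n. ennreal (c ^ Suc n) * \<eta> n)"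
proof -
  have "\<exists>w g. w \<in> borel_measurable M \<and> (\<forall>x. w x \<le> 1) \<and> (\<forall>x\<in>G n. w x = 1) \<and> upper_grad g w \<and> N w + N g < \<eta> n" for n
    using capacity_lessD[OF assms[of n]] by metis
  then obtain w g where wg: "\<And>n. w n \<in> borel_measurable M" "\<And>n x. w n x \<le> 1" "\<And>n x. x \<in> G n \<Longrightarrow> w n x = 1"
      "\<And>n. upper_grad (g n) (w n)" "\<And>n. N (w n) + N (g n) < \<eta> n"
    by metis
  note [measurable] = wg(1)
  have [measurable]: "\<And>n. g n \<in> borel_measurable borel" using wg(4) by (simp add: upper_grad_def)
  then have [measurable]: "\<And>n. g n \<in> borel_measurable M" by (rule borel_imp_measurable)
  have le_suminf: "f n \<le> (\<Sum>n. f n)" for f :: "nat \<Rightarrow> ennreal" and n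
    using sum_le_suminf[of f "{n}"] by simp
  define W where "W x = (SUP n. w n x)" for x
  define k where "k x = (\<Sum>n. g n x)" for x
  have "capacity M nX (\<Union>n. G n) \<le> N W + N k"
  proof (rule capacity_leI)
    show "W \<in> borel_measurable M" unfolding W_def by measurable
    show W1: "W x \<le> 1" for x unfolding W_def using wg(2) by (intro SUP_least)
    show "W x = 1" if "x \<in> (\<Union>n. G n)" for x
    proof (rule antisym[OF W1])
      show "1 \<le> W x" using that wg(3) unfolding W_def by (metis UN_E SUP_upper UNIV_I)
    qed
    show "upper_grad k W"
      unfolding upper_grad_def
    proof (intro conjI allI impI)
      show "k \<in> borel_measurable borel" unfolding k_def by measurable
      fix \<gamma> :: "real \<Rightarrow> 'a" and l :: real assume arc: "arc_length_curve \<gamma> l"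
      have int: "line_integral (g n) \<gamma> l \<le> line_integral k \<gamma> l" for n
        unfolding k_def by (intro line_integral_mono le_suminf)
      have up: "w n x \<le> W x" for n x unfolding W_def by (rule SUP_upper) simp
      have "w n (\<gamma> 0) \<le> W (\<gamma> l) + line_integral k \<gamma> l \<and> w n (\<gamma> l) \<le> W (\<gamma> 0) + line_integral k \<gamma> l" for n
        using wg(4)[of n] arc add_mono[OF up int] unfolding upper_grad_def by (meson order_trans)
      then show "W (\<gamma> 0) \<le> W (\<gamma> l) + line_integral k \<gamma> l" "W (\<gamma> l) \<le> W (\<gamma> 0) + line_integral k \<gamma> l"
        unfolding W_def[of "\<gamma> 0"] W_def[of "\<gamma> l"] by (auto intro!: SUP_least simp: W_def)
    qed
  qed
  also have "N W \<le> N (\<lambda>x. \<Sum>n. w n x)"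
    unfolding W_def by (intro N_mono SUP_least le_suminf) measurable
  also have "\<dots> \<le> (\<Sum>n. ennreal (c ^ Suc n) * N (w n))" by (rule N_suminf) (rule wg(1))
  also have "N k \<le> (\<Sum>n. ennreal (c ^ Suc n) * N (g n))" unfolding k_def by (rule N_suminf) simp
  also have "(\<Sum>n. ennreal (c ^ Suc n) * N (w n)) + (\<Sum>n. ennreal (c ^ Suc n) * N (g n))
      = (\<Sum>n. ennreal (c ^ Suc n) * (N (w n) + N (g n)))"
    by (simp add: suminf_add[OF summableI summableI] distrib_left)
  also have "\<dots> \<le> (\<Sum>n. ennreal (c ^ Suc n) * \<eta> n)"
    using wg(5) by (intro suminf_le mult_left_mono) (auto intro: less_imp_le)
  finally show ?thesis by (simp add: add_mono)
qed

text \<open>A curve that starts in \<open>ball d \<rho>\<close> and leaves \<open>ball d (2 * \<rho>)\<close> has length at least \<open>\<rho>\<close>, so the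
  term \<open>h / \<rho>\<close> in the gradient pays for cutting \<open>h\<close> off outside \<open>ball d (2 * \<rho>)\<close>.\<close>

lemma open_neighbourhood_in_compact_ball:
  assumes \<rho>: "0 < \<rho>" and cpt: "compact (cball d (2 * \<rho>))" and A: "A \<subseteq> ball d \<rho>"
    and e: "0 < e" and cap: "capacity M nX A < ennreal e"
  obtains G where "open G" "A \<subseteq> G" "capacity M nX G \<le> ennreal ((3 + c * (2 + 2 / \<rho>)) * e)"
proof -
  obtain w g where [measurable]: "w \<in> borel_measurable M" and w: "\<And>x. x \<in> A \<Longrightarrow> w x = 1"
    and upper_grad: "upper_grad g w" and Nwg: "N w + N g < ennreal e"
    using cap by (rule capacity_lessD) blast
  have gb: "g \<in> borel_measurable borel" using upper_grad by (simp add: upper_grad_def)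
  then have [measurable]: "g \<in> borel_measurable M" by (rule borel_imp_measurable)
  have Nw: "N w < ennreal e" and Ng: "N g < ennreal e"
    using Nwg by (auto intro: le_less_trans[rotated] simp: add_increasing add_increasing2)
  \<comment> \<open>Any factor above 1 would give the strict superlevel set; 2 is convenient, as
    constants do not matter here.\<close>
  have "N (\<lambda>x. ennreal 2 * w x) = ennreal 2 * N w" by (intro N_cmult) auto
  also have "\<dots> < ennreal (2 * e)"
    using Nw by (cases "N w") (auto simp flip: ennreal_mult' ennreal_numeral simp: ennreal_less_iff)
  finally obtain h where h: "lsc_ennreal h" "\<And>x. ennreal 2 * w x \<le> h x" "N h < ennreal (2 * e)"
    by (rule lsc_majorant[rotated]) auto
  have hb: "h \<in> borel_measurable borel" using h(1) by (rule lsc_ennreal_measurable)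
  then have [measurable]: "h \<in> borel_measurable M" by (rule borel_imp_measurable)
  define f where "f x = ennreal 2 * g x + ennreal (1 / \<rho>) * h x" for x
  have [measurable]: "f \<in> borel_measurable M" unfolding f_def by measurable
  have "N f \<le> ennreal c * (N (\<lambda>x. ennreal 2 * g x) + N (\<lambda>x. ennreal (1 / \<rho>) * h x))"
    unfolding f_def by (intro N_add) auto
  also have "\<dots> = ennreal c * (ennreal 2 * N g + ennreal (1 / \<rho>) * N h)"
    using \<rho> by (subst (1 2) N_cmult) auto
  also have "\<dots> \<le> ennreal c * (ennreal 2 * ennreal e + ennreal (1 / \<rho>) * ennreal (2 * e))"
    using Ng h(3) by (intro mult_left_mono add_mono) auto
  also have "\<dots> = ennreal (c * (2 * e + (1 / \<rho>) * (2 * e)))"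
    using c e \<rho> by (simp flip: ennreal_mult ennreal_plus del: ennreal_numeral)
  \<comment> \<open>The additional \<open>e\<close> provides the strict inequality under which a
    lower semicontinuous majorant can be chosen.\<close>
  also have "\<dots> < ennreal (c * (2 * e + (1 / \<rho>) * (2 * e)) + e)"
    using c e \<rho> by (intro ennreal_lessI) (auto intro!: add_nonneg_pos)
  finally obtain k where k: "lsc_ennreal k" "\<And>x. f x \<le> k x" "N k < ennreal (c * (2 * e + (1 / \<rho>) * (2 * e)) + e)"
    by (rule lsc_majorant[rotated]) auto
  \<comment> \<open>Cutting off at an open ball preserves lower semicontinuity; the compact closed
    ball of the same radius serves as the set outside which \<open>h'\<close> vanishes.\<close>
  define U where "U = ball d (2 * \<rho>)"
  define h' where "h' x = h x * indicator U x" for x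
  have h': "lsc_ennreal h'" unfolding h'_def U_def by (intro lsc_ennreal_indicator h(1)) simp
  have h'h: "h' x \<le> h x" for x by (auto simp: h'_def split: split_indicator)
  have k_ge: "ennreal (1 / \<rho>) * h' x \<le> k x" for x
  proof -
    have "ennreal (1 / \<rho>) * h' x \<le> f x" unfolding f_def using h'h by (intro add_increasing mult_left_mono) auto
    then show ?thesis using k(2) order_trans by blast
  qed
  have cpt': "compact (cball x R \<inter> cball d (2 * \<rho>))" for x R using cpt by (intro closed_Int_compact) auto
  have h'0: "h' x = 0" if "x \<notin> cball d (2 * \<rho>)" for x using that by (auto simp: h'_def U_def)
  have "0 < 1 / \<rho>" using \<rho> by simp
  note cap_le = capacity_curve_inf_le[OF h' k(1) this k_ge closed_cball h'0 cpt']
  have two: "2 \<le> curve_inf h' k x" if x: "x \<in> A" for x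
  proof (rule curve_inf_greatest)
    fix \<gamma> :: "real \<Rightarrow> 'a" and T :: real assume \<gamma>: "lip1 \<gamma>" "0 \<le> T" "\<gamma> 0 = x"
    \<comment> \<open>The integral is taken over the whole curve, so that the estimate
      \<open>along\<close> holds with the same \<open>I\<close> at all times.\<close>
    define I where "I = line_integral (\<lambda>x. ennreal 2 * g x) \<gamma> T"
    have along: "2 \<le> h (\<gamma> t) + I" if t: "t \<in> {0..T}" for t
    proof -
      have "ennreal 2 * 1 \<le> ennreal 2 * (w (\<gamma> t) + line_integral g \<gamma> t)"
        using upper_grad_lip1[OF upper_grad \<gamma>(1), of t] t \<gamma>(3) w[OF x] by (intro mult_left_mono) auto
      also have "\<dots> = ennreal 2 * w (\<gamma> t) + line_integral (\<lambda>x. ennreal 2 * g x) \<gamma> t"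
        by (simp only: distrib_left line_integral_cmult[OF \<gamma>(1) gb])
      also have "\<dots> \<le> h (\<gamma> t) + I"
        unfolding I_def using t by (intro add_mono h(2) line_integral_mono_time) auto
      finally show ?thesis by simp
    qed
    have "line_integral f \<gamma> T = I + ennreal (1 / \<rho>) * line_integral h \<gamma> T"
      unfolding f_def I_def using gb hb by (simp add: line_integral_add[OF \<gamma>(1)] line_integral_cmult[OF \<gamma>(1)])
    moreover have "line_integral f \<gamma> T \<le> line_integral k \<gamma> T" by (intro line_integral_mono k(2))
    ultimately have int: "I + ennreal (1 / \<rho>) * line_integral h \<gamma> T \<le> line_integral k \<gamma> T" by simp
    show "2 \<le> h' (\<gamma> T) + line_integral k \<gamma> T"
    proof (cases "\<gamma> T \<in> U")
      case True
      have "2 \<le> h' (\<gamma> T) + I" using along[of T] \<gamma>(2) True by (simp add: h'_def)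
      also have "\<dots> \<le> h' (\<gamma> T) + line_integral k \<gamma> T"
        using int by (intro add_left_mono) (meson add_increasing2 order_trans order_refl zero_le)
      finally show ?thesis .
    next
      case False
      then have "\<rho> \<le> T"
        using A x lip1D[OF \<gamma>(1), of 0 T] \<gamma>(2,3) dist_triangle[of d "\<gamma> T" x] by (fastforce simp: U_def)
      \<comment> \<open>By \<open>along\<close>, \<open>h\<close> is at least \<open>2 - I\<close>
        (truncated at 0) on the entire curve. Integration over a time of at least \<rho> makes the
        line integral of \<open>h / \<rho>\<close> at least \<open>2 - I\<close>, which replaces the
        lost end term.\<close>
      have "ennreal \<rho> * (2 - I) \<le> ennreal T * (2 - I)" using \<open>\<rho> \<le> T\<close> by (intro mult_right_mono ennreal_leI) auto
      also have "\<dots> = (\<integral>\<^sup>+ t. (2 - I) * indicator {0..T} t \<partial>lborel)"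
        using \<gamma>(2) by (subst nn_integral_cmult_indicator) (auto simp: mult.commute)
      also have "\<dots> \<le> line_integral h \<gamma> T"
        unfolding line_integral_def
      proof (intro nn_integral_mono)
        fix t
        show "(2 - I) * indicator {0..T} t \<le> h (\<gamma> t) * indicator {0..T} t"
          using along[of t] by (auto simp: ennreal_minus_le_iff add.commute split: split_indicator)
      qed
      finally have "ennreal (1 / \<rho>) * (ennreal \<rho> * (2 - I)) \<le> ennreal (1 / \<rho>) * line_integral h \<gamma> T"
        by (intro mult_left_mono) auto
      moreover have "ennreal (1 / \<rho>) * (ennreal \<rho> * (2 - I)) = 2 - I"
        using \<rho> by (simp flip: ennreal_mult mult.assoc)
      ultimately have "2 - I \<le> ennreal (1 / \<rho>) * line_integral h \<gamma> T" by simp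
      then have "2 \<le> I + ennreal (1 / \<rho>) * line_integral h \<gamma> T" by (simp add: ennreal_minus_le_iff)
      also note int
      finally show ?thesis by (simp add: add_increasing)
    qed
  qed
  show ?thesis
  proof (rule that)
    show "A \<subseteq> {x. 1 < curve_inf h' k x}"
    proof
      fix x assume "x \<in> A"
      have "(1::ennreal) < 2" by simp
      also have "\<dots> \<le> curve_inf h' k x" using two \<open>x \<in> A\<close> .
      finally show "x \<in> {x. 1 < curve_inf h' k x}" by simp
    qed
    show "open {x. 1 < curve_inf h' k x}" by (rule cap_le(1))
    have hb': "h' \<in> borel_measurable M" using h' by (intro borel_imp_measurable lsc_ennreal_measurable)
    have "capacity M nX {x. 1 < curve_inf h' k x} \<le> N h' + N k" by (rule cap_le(2))
    also have "\<dots> \<le> N h + N k" using hb' by (intro add_right_mono N_mono h'h) auto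
    also have "\<dots> \<le> ennreal (2 * e) + ennreal (c * (2 * e + (1 / \<rho>) * (2 * e)) + e)"
      using h(3) k(3) by (intro add_mono) auto
    also have "\<dots> = ennreal ((3 + c * (2 + 2 / \<rho>)) * e)"
      using c e \<rho> by (subst ennreal_plus[symmetric]) (auto simp: algebra_simps add_divide_distrib)
    finally show "capacity M nX {x. 1 < curve_inf h' k x} \<le> ennreal ((3 + c * (2 + 2 / \<rho>)) * e)" .
  qed
qed

theorem quasicontinuous_of_weakly_quasicontinuous:
  assumes lc: "locally_compact_space (euclidean :: 'a topology)" and u: "weakly_quasicontinuous M nX u"
  shows "quasicontinuous M nX u"
  unfolding quasicontinuous_def
proof (intro allI impI)
  fix \<epsilon> :: real assume \<epsilon>: "0 < \<epsilon>"
  obtain d :: "nat \<Rightarrow> 'a" and \<rho> where "\<forall>n. 0 < \<rho> n \<and> compact (cball (d n) (2 * \<rho> n))"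
    and cover: "\<And>x. \<exists>n. x \<in> ball (d n) (\<rho> n)"
    using countable_cover_compact_balls[OF mm lc] by blast
  then have \<rho>: "\<And>n. 0 < \<rho> n" and cpt: "\<And>n. compact (cball (d n) (2 * \<rho> n))" by auto
  define K where "K n = 3 + c * (2 + 2 / \<rho> n)" for n
  \<comment> \<open>The power of \<open>c\<close> cancels the weights in
    \<open>capacity_UN_le\<close>; the remaining geometric series sums to
    \<open>\<epsilon> / 2\<close>.\<close>
  define \<eta> where "\<eta> n = \<epsilon> / 2 * (1 / 2) ^ Suc n / c ^ Suc n" for n
  have K: "0 < K n" for n using c \<rho>[of n] by (auto simp: K_def intro!: add_pos_nonneg)
  have \<eta>: "0 < \<eta> n" for n using \<epsilon> c by (simp add: \<eta>_def)
  have pos: "0 < \<eta> n / 2 / K n" for n using K \<eta> by simp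
  \<comment> \<open>The cost factor \<open>K n\<close> depends on the radius of the ball and need
    not be bounded, so each ball gets its own exceptional set. Halving leaves room for a strict
    inequality.\<close>
  have "\<exists>E. capacity M nX E < ennreal (\<eta> n / 2 / K n) \<and> (\<forall>x \<in> - E. \<bar>u x\<bar> \<noteq> \<infinity>) \<and>
      continuous_on (- E) (\<lambda>x. real_of_ereal (u x))" for n
    using u pos[of n] by (auto simp: weakly_quasicontinuous_def)
  then obtain E where E: "\<And>n. capacity M nX (E n) < ennreal (\<eta> n / 2 / K n)"
    "\<And>n x. x \<notin> E n \<Longrightarrow> \<bar>u x\<bar> \<noteq> \<infinity>" "\<And>n. continuous_on (- E n) (\<lambda>x. real_of_ereal (u x))"
    by (metis ComplI)
  have "\<exists>G. open G \<and> E n \<inter> ball (d n) (\<rho> n) \<subseteq> G \<and> capacity M nX G < ennreal (\<eta> n)" for n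
  proof -
    have "capacity M nX (E n \<inter> ball (d n) (\<rho> n)) < ennreal (\<eta> n / 2 / K n)"
      using E(1) by (rule le_less_trans[OF capacity_mono, rotated]) auto
    then obtain G where G: "open G" "E n \<inter> ball (d n) (\<rho> n) \<subseteq> G" "capacity M nX G \<le> ennreal (K n * (\<eta> n / 2 / K n))"
      using open_neighbourhood_in_compact_ball[OF \<rho>[of n] cpt[of n] _ pos[of n], of "E n \<inter> ball (d n) (\<rho> n)"]
      unfolding K_def by auto
    have "capacity M nX G \<le> ennreal (\<eta> n / 2)" using G(3) K[of n] by simp
    also have "\<dots> < ennreal (\<eta> n)" using \<eta>[of n] by (intro ennreal_lessI) auto
    finally show ?thesis using G by blast
  qed
  then obtain G where G: "\<And>n. open (G n)" "\<And>n. E n \<inter> ball (d n) (\<rho> n) \<subseteq> G n"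
    "\<And>n. capacity M nX (G n) < ennreal (\<eta> n)"
    by metis
  show "\<exists>E. open E \<and> capacity M nX E < ennreal \<epsilon> \<and> (\<forall>x\<in>- E. \<bar>u x\<bar> \<noteq> \<infinity>) \<and>
      continuous_on (- E) (\<lambda>x. real_of_ereal (u x))"
  proof (intro exI[of _ "\<Union>n. G n"] conjI)
    show "open (\<Union>n. G n)" using G(1) by auto
    have "capacity M nX (\<Union>n. G n) \<le> (\<Sum>n. ennreal (c ^ Suc n) * ennreal (\<eta> n))"
      by (rule capacity_UN_le) (rule G(3))
    also have "\<dots> = (\<Sum>n. ennreal (\<epsilon> / 2 * (1 / 2) ^ Suc n))"
    proof (rule suminf_cong)
      fix n
      have "ennreal (c ^ Suc n) * ennreal (\<eta> n) = ennreal (c ^ Suc n * \<eta> n)"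
        using c \<eta>[of n] by (intro ennreal_mult[symmetric]) auto
      also have "c ^ Suc n * \<eta> n = \<epsilon> / 2 * (1 / 2) ^ Suc n" using c by (simp add: \<eta>_def)
      finally show "ennreal (c ^ Suc n) * ennreal (\<eta> n) = ennreal (\<epsilon> / 2 * (1 / 2) ^ Suc n)" .
    qed
    also have "\<dots> = ennreal (\<epsilon> / 2 * 1)"
      using \<epsilon> by (intro suminf_ennreal_eq sums_mult power_half_series) auto
    also have "\<dots> < ennreal \<epsilon>" using \<epsilon> by (intro ennreal_lessI) auto
    finally show "capacity M nX (\<Union>n. G n) < ennreal \<epsilon>" .
    have notE: "y \<notin> E n" if "y \<notin> (\<Union>n. G n)" "y \<in> ball (d n) (\<rho> n)" for y n
      using that G(2) by blast
    show "\<forall>x\<in>- (\<Union>n. G n). \<bar>u x\<bar> \<noteq> \<infinity>"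
    proof
      fix x assume x: "x \<in> - (\<Union>n. G n)"
      obtain n where "x \<in> ball (d n) (\<rho> n)" using cover by metis
      then have "x \<notin> E n" using notE x by simp
      then show "\<bar>u x\<bar> \<noteq> \<infinity>" by (rule E(2))
    qed
    show "continuous_on (- (\<Union>n. G n)) (\<lambda>x. real_of_ereal (u x))"
      unfolding continuous_on_eq_continuous_within
    proof
      fix x assume x: "x \<in> - (\<Union>n. G n)"
      obtain n where n: "x \<in> ball (d n) (\<rho> n)" using cover by metis
      have "x \<in> - E n" using notE[OF _ n] x by simp
      then have "continuous (at x within - E n) (\<lambda>x. real_of_ereal (u x))"
        using E(3)[of n] by (simp add: continuous_on_eq_continuous_within)
      then have "continuous (at x within - (\<Union>n. G n) \<inter> ball (d n) (\<rho> n)) (\<lambda>x. real_of_ereal (u x))"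
        by (rule continuous_within_subset) (use notE[of _ n] in auto)
      \<comment> \<open>Continuity is local: near \<open>x\<close> only the ball containing it
        matters, and there the complement of the union avoids \<open>E n\<close>.\<close>
      moreover have "at x within - (\<Union>n. G n) \<inter> ball (d n) (\<rho> n) = at x within - (\<Union>n. G n)"
        using n by (intro at_within_nhd[of x "ball (d n) (\<rho> n)"]) auto
      ultimately show "continuous (at x within - (\<Union>n. G n)) (\<lambda>x. real_of_ereal (u x))" by simp
    qed
  qed
qed

end

theorem theorem1p5:
  fixes M :: "'a::metric_space measure"
    and nX :: "('a \<Rightarrow> ereal) \<Rightarrow> ennreal"
  assumes "mm_space M"
    and "qBFL M nX"
    and "vitali_caratheodory M nX"
  shows "((\<forall>(x::'a) r. compact (cball x r)) \<longrightarrow> outer_capacity M nX)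
     \<and> (locally_compact_space (euclidean :: 'a topology) \<longrightarrow>
          (\<forall>u. weakly_quasicontinuous M nX u \<longrightarrow> quasicontinuous M nX u))"
proof -
  obtain c :: real where c: "1 \<le> c"
    and null: "\<forall>u. u \<in> borel_measurable M \<longrightarrow> (nX u = 0 \<longleftrightarrow> (AE x in M. u x = 0))"
    and scale: "\<forall>u (a::real). u \<in> borel_measurable M \<longrightarrow> nX (\<lambda>x. ereal a * u x) = ennreal \<bar>a\<bar> * nX u"
    and add: "\<forall>u v. u \<in> borel_measurable M \<longrightarrow> v \<in> borel_measurable M \<longrightarrow>
      nX (\<lambda>x. u x + v x) \<le> ennreal c * (nX u + nX v)"
    and mono: "\<forall>u v. u \<in> borel_measurable M \<longrightarrow> v \<in> borel_measurable M \<longrightarrow>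
      (AE x in M. \<bar>u x\<bar> \<le> \<bar>v x\<bar>) \<longrightarrow> nX u \<le> nX v"
    and suminf: "\<forall>us :: nat \<Rightarrow> 'a \<Rightarrow> ereal. (\<forall>n. us n \<in> borel_measurable M \<and> (\<forall>x. 0 \<le> us n x)) \<longrightarrow>
      nX (\<lambda>x. \<Sum>n. us n x) \<le> (\<Sum>n. ennreal (c ^ Suc n) * nX (us n))"
    using assms(2) unfolding qBFL_def by (elim conjE exE) (rule that)
  have cont: "\<forall>us u. (\<forall>n. in_X M nX (us n)) \<longrightarrow> in_X M nX u \<longrightarrow>
      (\<lambda>n. nX (\<lambda>x. us n x - u x)) \<longlonglongrightarrow> 0 \<longrightarrow> (\<lambda>n. nX (us n)) \<longlonglongrightarrow> nX u"
    using assms(2) unfolding qBFL_def by (rule conjunct2)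
  interpret function_lattice M nX c
  proof
    fix u :: "'a \<Rightarrow> ereal" assume "u \<in> borel_measurable M"
    then show "nX u = 0 \<longleftrightarrow> (AE x in M. u x = 0)" using null by blast
  qed (use assms(1,3) c scale add mono suminf cont in simp_all)
  show ?thesis
    using outer_capacity_of_proper quasicontinuous_of_weakly_quasicontinuous by blast
qed

end
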